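(* Let $\varphi$ be an endomorphism of $A_1$ of subrectangular type which is not an automorphism, and put $P=\varphi(x)$, $Q=\varphi(\partial)$ (so $[Q,P]=1$ and $(P,Q)$ is a subrectangular DC-pair). Let $\operatorname{ord}(P)=p=dn$, $\operatorname{ord}(Q)=q=dm$ with $d>1$, $(n,m)=1$, let $Hm(P)=x^{ln}y^{dn}$ with $l<d$, and assume $\operatorname{ord}(P)=\mathbf{ord}(P)$ and $\operatorname{ord}(Q)=\mathbf{ord}(Q)$. (Then $Hm(Q)=x^{ml}y^{md}$ and the rate of $\varphi$ is $\epsilon(\varphi)=n/m$.) Let $K\subset\mathbb{C}$ be the subfield generated over $\mathbb{Q}$ by all non-zero coefficients of the monomials of $P$ and of $Q$. Then there exist an index $I$, natural numbers $n_0,\ldots,n_I$ and $m_0,\ldots,m_I$, constants $\varepsilon_0,\ldots,\varepsilon_I\in K$, and polynomials $F_i(X,Y)\in K[X,Y]$, $i=0,\ldots,I$, defined recursively by $F_0(X,Y)=Y$ and $F_{i+1}(X,Y)=F_i(X,Y)^{n_i}-\varepsilon_i^{n_i}X^{m_i}$, such that, with $d_2:=EssGCD(P,Q)$: 1. for every $i<I$, $d_2$ divides $GCD\{\operatorname{ord}(P),\operatorname{ord}(F_0(P,Q)),\ldots,\operatorname{ord}(F_i(P,Q))\}$, and this GCD divides $d$; 2. $\operatorname{ord}(F_I(P,Q))\equiv 1 \mod GCD\{\operatorname{ord}(P),\operatorname{ord}(F_0(P,Q)),\ldots,\operatorname{ord}(F_{I-1}(P,Q))\}$. Moreover, $$\sum_{i=0}^{I-1}\bigl(n_i\operatorname{ord}F_i(P,Q)-\operatorname{ord}F_{i+1}(P,Q)\bigr)=p+q-1,$$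 and $\operatorname{ord}F_i(P,Q)=\mathbf{ord}\,F_i(P,Q)$ for all $i=0,\ldots,I$.
   Context: $A_1=\mathbb{C}[x][\partial]$ is the first Weyl algebra, $[\partial,x]=1$. For $0\ne P=\sum a_{ij}x^i\partial^j\in A_1$ put $E(P)=\{(i,j):a_{ij}\neq0\}$; the Newton polygon of $P$ is the convex hull of $E(P)$. $\operatorname{ord}(P)=\max\{j:(i,j)\in E(P)\}$, $\operatorname{ord}_x(P)=\max\{i:(i,j)\in E(P)\}$, $\mathbf{ord}(P)=\max\{j-i:(i,j)\in E(P)\}$. $P$ is of subrectangular type if for some integers $l,k\ge1$ its Newton polygon is contained in the rectangle with vertices $(0,0),(0,k),(l,0),(l,k)$ and $(l,k)$ is a vertex of the Newton polygon; then $Hm(P):=x^ly^k$ is the highest monomial of $P$. An endomorphism $\varphi$ of $A_1$ is of subrectangular type if $\varphi(x)$ and $\varphi(\partial)$ are. In that case, if $Hm(\varphi(\partial))=x^ly^k$ and $Hm(\varphi(x))=x^{l'}y^{k'}$, one has $(l',k')=\epsilon(\varphi)(l,k)$ for a rational number $\epsilon(\varphi)$, called the rate. A DC-pair is a pair $P=\varphi(x)$, $Q=\varphi(\partial)$ with $\varphi\in\operatorname{End}(A_1)\setminus\operatorname{Aut}(A_1)$. Convention: $(n,m)=1$ means $GCD(m,n)=1$ and $m,n>1$. $EssGCD(P,Q):=\dfrac{d}{GCD(l,d)}$, where $d=GCD(\operatorname{ord}(P),\operatorname{ord}(Q))$ and $l=GCD(\operatorname{ord}_x(P),\operatorname{ord}_x(Q))$.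 The operators $F_i(P,Q)\in A_1$ are obtained by running the recursion in $A_1$: $F_0(P,Q)=Q$, $F_{i+1}(P,Q)=F_i(P,Q)^{n_i}-\varepsilon_i^{n_i}P^{m_i}$. *)

theory Defs
  imports
    "HOL-Analysis.Analysis"
    "HOL-Computational_Algebra.Polynomial"
    "HOL-Number_Theory.Cong"
begin

text \<open>
  An operator \<open>\<Sum>\<^sub>j a\<^sub>j(x) \<partial>\<^sup>j\<close> in normal form is stored as the polynomial in \<open>\<partial>\<close>
  with coefficients \<open>a\<^sub>j\<close> in \<open>\<complex>[x]\<close>.
\<close>

typedef weyl = "UNIV :: complex poly poly set"
  by simp

setup_lifting type_definition_weyl

text \<open>
  Left multiplication by \<open>\<partial>\<close>: the relation \<open>[\<partial>, x] = 1\<close> gives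
  \<open>\<partial> \<Sum>\<^sub>j a\<^sub>j \<partial>\<^sup>j = \<Sum>\<^sub>j (a\<^sub>j \<partial>\<^bsup>j+1\<^esup> + a\<^sub>j' \<partial>\<^sup>j)\<close>.
\<close>

definition d_left :: "complex poly poly \<Rightarrow> complex poly poly" where
  "d_left Q = pCons 0 Q + map_poly pderiv Q"

definition normal_mult :: "complex poly poly \<Rightarrow> complex poly poly \<Rightarrow> complex poly poly" where
  "normal_mult P Q = (\<Sum>j\<le>degree P. smult (coeff P j) ((d_left ^^ j) Q))"

lemma d_left_add: "d_left (P + Q) = d_left P + d_left Q"
  by (intro poly_eqI) (simp add: d_left_def coeff_map_poly coeff_pCons pderiv_add split: nat.split)

lemma d_left_0 [simp]: "d_left 0 = 0"
  by (simp add: d_left_def)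

lemma d_left_smult: "d_left (smult a Q) = smult a (d_left Q) + smult (pderiv a) Q"
  by (intro poly_eqI)
     (simp add: d_left_def coeff_map_poly coeff_pCons pderiv_mult algebra_simps split: nat.split)

lemma d_left_sum: "d_left (sum f A) = (\<Sum>x\<in>A. d_left (f x))"
  by (induction A rule: infinite_finite_induct) (auto simp: d_left_add)

lemma d_left_pow_add: "(d_left ^^ j) (P + Q) = (d_left ^^ j) P + (d_left ^^ j) Q"
  by (induction j) (auto simp: d_left_add)

lemma d_left_pow_0 [simp]: "(d_left ^^ j) 0 = 0"
  by (induction j) auto

lemma smult_sum_poly: "smult a (sum f A) = (\<Sum>x\<in>A. smult a (f x))"
  by (induction A rule: infinite_finite_induct) (auto simp: smult_add_right)

lemma normal_mult_bound:
  assumes "degree P \<le> N"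
  shows "normal_mult P Q = (\<Sum>j\<le>N. smult (coeff P j) ((d_left ^^ j) Q))"
  unfolding normal_mult_def
  by (rule sum.mono_neutral_left) (use assms in \<open>auto simp: coeff_eq_0\<close>)

lemma normal_mult_add_left: "normal_mult (P + P') Q = normal_mult P Q + normal_mult P' Q"
proof -
  let ?N = "max (degree P) (degree P')"
  have "degree (P + P') \<le> ?N" by (rule degree_add_le) auto
  then show ?thesis
    by (simp add: normal_mult_bound[of _ ?N] smult_add_left sum.distrib)
qed

lemma normal_mult_add_right: "normal_mult P (Q + Q') = normal_mult P Q + normal_mult P Q'"
  by (simp add: normal_mult_def d_left_pow_add smult_add_right sum.distrib)

lemma normal_mult_0_left [simp]: "normal_mult 0 Q = 0"
  by (simp add: normal_mult_def)

lemma normal_mult_0_right [simp]: "normal_mult P 0 = 0"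
  by (simp add: normal_mult_def)

lemma normal_mult_smult_left: "normal_mult (smult a P) Q = smult a (normal_mult P Q)"
  using degree_smult_le[of a P]
  by (simp add: normal_mult_bound[of _ "degree P"] smult_sum_poly)

lemma normal_mult_sum_left: "normal_mult (sum f A) Q = (\<Sum>x\<in>A. normal_mult (f x) Q)"
  by (induction A rule: infinite_finite_induct) (auto simp: normal_mult_add_left)

lemma normal_mult_pCons:
  "normal_mult (pCons a P) Q = smult a Q + normal_mult P (d_left Q)"
proof -
  have "normal_mult (pCons a P) Q
      = (\<Sum>j\<le>Suc (degree P). smult (coeff (pCons a P) j) ((d_left ^^ j) Q))"
    by (rule normal_mult_bound) (rule degree_pCons_le)
  also have "\<dots> = smult a Q + normal_mult P (d_left Q)"
    by (subst sum.atMost_Suc_shift)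
       (simp add: normal_mult_def funpow_swap1 del: sum.atMost_Suc)
  finally show ?thesis .
qed

lemma d_left_pow_d_left: "(d_left ^^ j) (d_left Q) = d_left ((d_left ^^ j) Q)"
  by (simp add: funpow_swap1)

lemma normal_mult_d_left: "normal_mult (d_left P) Q = d_left (normal_mult P Q)"
proof -
  have "degree (map_poly pderiv P) \<le> degree P"
    by (rule degree_le) (simp add: coeff_map_poly coeff_eq_0)
  then have "normal_mult (d_left P) Q
      = (\<Sum>j\<le>degree P. smult (coeff P j) ((d_left ^^ j) (d_left Q)))
        + (\<Sum>j\<le>degree P. smult (pderiv (coeff P j)) ((d_left ^^ j) Q))"
    by (simp add: d_left_def[of P] normal_mult_add_left normal_mult_pCons
        normal_mult_bound[of "map_poly pderiv P" "degree P"] coeff_map_poly)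
       (simp add: normal_mult_def)
  also have "\<dots> = d_left (normal_mult P Q)"
    by (simp add: normal_mult_def d_left_sum d_left_smult sum.distrib d_left_pow_d_left)
  finally show ?thesis .
qed

lemma normal_mult_d_left_pow:
  "normal_mult ((d_left ^^ j) P) Q = (d_left ^^ j) (normal_mult P Q)"
  by (induction j) (auto simp: normal_mult_d_left)

lemma normal_mult_assoc:
  "normal_mult (normal_mult P Q) R = normal_mult P (normal_mult Q R)"
  by (simp add: normal_mult_def[of P] normal_mult_sum_left normal_mult_smult_left
      normal_mult_d_left_pow)

lemma normal_mult_1_left: "normal_mult 1 Q = Q"
  by (simp add: normal_mult_def)

lemma d_left_pow_1: "(d_left ^^ j) 1 = monom 1 j"
proof (induction j)
  case (Suc j)
  have "map_poly pderiv (monom (1 :: complex poly) j) = 0"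
    by (intro poly_eqI) (simp add: coeff_map_poly)
  with Suc show ?case by (simp add: d_left_def monom_Suc)
qed (simp add: monom_0 one_pCons)

lemma normal_mult_1_right: "normal_mult P 1 = P"
  by (simp add: normal_mult_def d_left_pow_1 smult_monom poly_as_sum_of_monoms)

instantiation weyl :: ring_1
begin

lift_definition zero_weyl :: weyl is "0" .
lift_definition one_weyl :: weyl is "1" .
lift_definition plus_weyl :: "weyl \<Rightarrow> weyl \<Rightarrow> weyl" is "(+)" .
lift_definition minus_weyl :: "weyl \<Rightarrow> weyl \<Rightarrow> weyl" is "(-)" .
lift_definition uminus_weyl :: "weyl \<Rightarrow> weyl" is "uminus" .
lift_definition times_weyl :: "weyl \<Rightarrow> weyl \<Rightarrow> weyl" is normal_mult .

instance
  by standard (transfer; simp add: normal_mult_assoc normal_mult_1_left normal_mult_1_right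
    normal_mult_add_left normal_mult_add_right)+

end

lift_definition weyl_x :: weyl is "[:[:0, 1:]:]" .

lift_definition weyl_d :: weyl is "[:0, 1:]" .

lift_definition weyl_scale :: "complex \<Rightarrow> weyl \<Rightarrow> weyl" is "\<lambda>c. smult [:c:]" .

text \<open>The coefficient \<open>a\<^sub>i\<^sub>j\<close> of \<open>x\<^sup>i \<partial>\<^sup>j\<close>.\<close>

lift_definition weyl_coeff :: "weyl \<Rightarrow> nat \<Rightarrow> nat \<Rightarrow> complex" is
  "\<lambda>P i j. coeff (coeff P j) i" .

lemma weyl_commutator: "weyl_d * weyl_x - weyl_x * weyl_d = 1"
  by transfer (simp add: normal_mult_def d_left_def map_poly_pCons pderiv_pCons one_pCons)

lemma weyl_x_power: "weyl_x ^ i = Abs_weyl [:monom 1 i:]"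
proof (induction i)
  case 0
  show ?case by (simp add: one_weyl.abs_eq one_pCons)
next
  case (Suc i)
  then show ?case
    by (simp add: weyl_x.abs_eq times_weyl.abs_eq normal_mult_def monom_Suc)
qed

lemma weyl_d_power: "weyl_d ^ j = Abs_weyl (monom 1 j)"
proof (induction j)
  case 0
  show ?case by (simp add: one_weyl.abs_eq one_pCons monom_0)
next
  case (Suc j)
  have "map_poly pderiv (monom (1 :: complex poly) j) = 0"
    by (intro poly_eqI) (simp add: coeff_map_poly)
  with Suc show ?case
    by (simp add: weyl_d.abs_eq times_weyl.abs_eq normal_mult_def d_left_def monom_Suc)
qed

lemma weyl_coeff_monomial:
  "weyl_coeff (weyl_x ^ i * weyl_d ^ j) a b = (if a = i \<and> b = j then 1 else 0)"
proof -
  have "normal_mult [:monom 1 i:] (monom 1 j) = monom (monom 1 i) j"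
    by (simp add: normal_mult_def smult_monom)
  then show ?thesis
    by (simp add: weyl_x_power weyl_d_power times_weyl.abs_eq weyl_coeff.abs_eq)
qed

definition weyl_endo :: "(weyl \<Rightarrow> weyl) \<Rightarrow> bool" where
  "weyl_endo \<phi> \<longleftrightarrow>
     \<phi> 1 = 1 \<and>
     (\<forall>P Q. \<phi> (P + Q) = \<phi> P + \<phi> Q) \<and>
     (\<forall>P Q. \<phi> (P * Q) = \<phi> P * \<phi> Q) \<and>
     (\<forall>c P. \<phi> (weyl_scale c P) = weyl_scale c (\<phi> P))"

definition weyl_auto :: "(weyl \<Rightarrow> weyl) \<Rightarrow> bool" where
  "weyl_auto \<phi> \<longleftrightarrow> weyl_endo \<phi> \<and> bij \<phi>"

definition weyl_supp :: "weyl \<Rightarrow> (nat \<times> nat) set" where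
  "weyl_supp P = {(i, j). weyl_coeff P i j \<noteq> 0}"

definition newton_polygon :: "weyl \<Rightarrow> (real \<times> real) set" where
  "newton_polygon P = convex hull ((\<lambda>(i, j). (real i, real j)) ` weyl_supp P)"

text \<open>The three orders are meaningful for \<open>P \<noteq> 0\<close> only.\<close>

definition weyl_ord :: "weyl \<Rightarrow> nat" where
  "weyl_ord P = Max ((\<lambda>(i, j). j) ` weyl_supp P)"

definition weyl_ord_x :: "weyl \<Rightarrow> nat" where
  "weyl_ord_x P = Max ((\<lambda>(i, j). i) ` weyl_supp P)"

definition weyl_bold_ord :: "weyl \<Rightarrow> int" where
  "weyl_bold_ord P = Max ((\<lambda>(i, j). int j - int i) ` weyl_supp P)"

text \<open>
  \<open>has_Hm P l k\<close>: the operator \<open>P\<close> is of subrectangular type with \<open>Hm(P) = x\<^sup>l y\<^sup>k\<close>;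
  the exponents \<open>l, k\<close> are uniquely determined by \<open>P\<close>.
\<close>

definition has_Hm :: "weyl \<Rightarrow> nat \<Rightarrow> nat \<Rightarrow> bool" where
  "has_Hm P l k \<longleftrightarrow>
     P \<noteq> 0 \<and> l \<ge> 1 \<and> k \<ge> 1 \<and>
     newton_polygon P \<subseteq> {0..real l} \<times> {0..real k} \<and>
     (real l, real k) extreme_point_of newton_polygon P"

definition subrectangular :: "weyl \<Rightarrow> bool" where
  "subrectangular P \<longleftrightarrow> (\<exists>l k. has_Hm P l k)"

definition subrectangular_endo :: "(weyl \<Rightarrow> weyl) \<Rightarrow> bool" where
  "subrectangular_endo \<phi> \<longleftrightarrow>
     weyl_endo \<phi> \<and> subrectangular (\<phi> weyl_x) \<and> subrectangular (\<phi> weyl_d)"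

definition EssGCD :: "weyl \<Rightarrow> weyl \<Rightarrow> nat" where
  "EssGCD P Q =
     (let d = gcd (weyl_ord P) (weyl_ord Q);
          l = gcd (weyl_ord_x P) (weyl_ord_x Q)
      in d div gcd l d)"

definition is_subfield :: "complex set \<Rightarrow> bool" where
  "is_subfield K \<longleftrightarrow>
     0 \<in> K \<and> 1 \<in> K \<and>
     (\<forall>a\<in>K. \<forall>b\<in>K. a - b \<in> K \<and> a * b \<in> K) \<and>
     (\<forall>a\<in>K. inverse a \<in> K)"

text \<open>Every subfield of \<open>\<complex>\<close> contains \<open>\<rat>\<close>, so generation over \<open>\<rat>\<close> needs no extra generators.\<close>

definition coeff_field :: "weyl \<Rightarrow> weyl \<Rightarrow> complex set" where
  "coeff_field P Q =
     is_subfield hull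
       ({weyl_coeff P i j |i j. (i, j) \<in> weyl_supp P} \<union>
        {weyl_coeff Q i j |i j. (i, j) \<in> weyl_supp Q})"

text \<open>
  \<open>K[X, Y]\<close> inside \<open>\<complex>[X][Y]\<close>: the inner indeterminate \<open>[:[:0, 1:]:]\<close> is \<open>X\<close>,
  the outer one \<open>[:0, 1:]\<close> is \<open>Y\<close>.
\<close>

definition bipoly_over :: "complex set \<Rightarrow> complex poly poly set" where
  "bipoly_over K = {F. \<forall>i j. coeff (coeff F j) i \<in> K}"

primrec F_poly :: "(nat \<Rightarrow> nat) \<Rightarrow> (nat \<Rightarrow> nat) \<Rightarrow> (nat \<Rightarrow> complex) \<Rightarrow> nat \<Rightarrow> complex poly poly"
where
  "F_poly n m \<epsilon> 0 = [:0, 1:]"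
| "F_poly n m \<epsilon> (Suc i) = F_poly n m \<epsilon> i ^ n i - smult [:\<epsilon> i ^ n i:] ([:[:0, 1:]:] ^ m i)"

text \<open>
  Since \<open>P\<close> and \<open>Q\<close> need not commute, \<open>F\<^sub>i(P, Q)\<close> is not an evaluation of the
  commutative polynomial \<open>F\<^sub>i\<close>, but the result of the same recursion in the Weyl algebra.
\<close>

primrec F_op ::
  "(nat \<Rightarrow> nat) \<Rightarrow> (nat \<Rightarrow> nat) \<Rightarrow> (nat \<Rightarrow> complex) \<Rightarrow> weyl \<Rightarrow> weyl \<Rightarrow> nat \<Rightarrow> weyl"
where
  "F_op n m \<epsilon> P Q 0 = Q"
| "F_op n m \<epsilon> P Q (Suc i) = F_op n m \<epsilon> P Q i ^ n i - weyl_scale (\<epsilon> i ^ n i) (P ^ m i)"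

end

theory Submission
  imports Defs "HOL-Computational_Algebra.Fundamental_Theorem_Algebra"
begin

text \<open>
  Write \<open>a\<close> for the leading coefficient of \<open>P\<close> as a polynomial in \<open>\<partial>\<close> and \<open>f\<close> for that of an operator
  \<open>F\<close> of order \<open>s\<close>. The coefficient of \<open>[F, P]\<close> in degree \<open>s + p - 1\<close> is \<open>W = s f a' - p a f'\<close>.
  As long as \<open>W = 0\<close>, \<open>f\<^sup>p\<close> is a constant multiple of \<open>a\<^sup>s\<close>, so subtracting a multiple of \<open>P\<^sup>s\<close> from
  \<open>F\<^sup>p\<close> lowers the order; \<open>s + p - 1 - ord [F, P]\<close> then decreases, so that, starting from \<open>Q\<close>, some
  \<open>F\<close> with \<open>W \<noteq> 0\<close> is reached. Counting orders in \<open>[F, P]\<close> along the way, where \<open>[Q, P] = 1\<close>, gives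
  the sum formula and the congruence.

  For the last operator it remains to see \<open>f(0) \<noteq> 0\<close>. Since \<open>[F, P]\<close> is built from the previous
  operators, \<open>W\<^sup>p\<close> is a multiple of a power of \<open>a\<close>. Comparing vanishing orders at each root of \<open>a\<close>, and
  comparing degrees (here \<open>l < d\<close> enters), shows that \<open>f\<close> vanishes at the roots of \<open>a\<close> to such an
  order that no further root of \<open>f\<close> is possible; but \<open>a(0) \<noteq> 0\<close>.
\<close>

section \<open>Weighted Wronskians\<close>

lemma coeff_mult_at_degree_bound:
  fixes f g :: "'a::comm_semiring_0 poly"
  assumes "degree f \<le> m" "degree g \<le> n"
  shows "coeff (f * g) (m + n) = coeff f m * coeff g n"
proof -
  have "coeff (f * g) (m + n) = (\<Sum>i\<le>m + n. coeff f i * coeff g (m + n - i))"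
    by (simp add: coeff_mult)
  also have "\<dots> = (\<Sum>i\<in>{m}. coeff f i * coeff g (m + n - i))"
  proof (rule sum.mono_neutral_right)
    show "\<forall>i\<in>{..m + n} - {m}. coeff f i * coeff g (m + n - i) = 0"
    proof
      fix i assume i: "i \<in> {..m + n} - {m}"
      show "coeff f i * coeff g (m + n - i) = 0"
      proof (cases "i < m")
        case True
        then have "degree g < m + n - i" using assms by simp
        then show ?thesis by (simp add: coeff_eq_0)
      next
        case False
        then have "degree f < i" using i assms by simp
        then show ?thesis by (simp add: coeff_eq_0)
      qed
    qed
  qed auto
  finally show ?thesis by simp
qed

text \<open>Divided by \<open>f * a\<close>, this is the logarithmic derivative of
  \<open>a ^ s / f ^ p\<close>. It is also the Poisson bracket of the principal parts of two
  operators of orders \<open>s\<close> and \<open>p\<close>, up to the power of the second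
  variable.\<close>

definition wronskian :: "nat \<Rightarrow> nat \<Rightarrow> complex poly \<Rightarrow> complex poly \<Rightarrow> complex poly" where
  "wronskian s p f a = of_nat s * f * pderiv a - of_nat p * a * pderiv f"

text \<open>
  Multiplying by the indeterminate (\<open>pCons 0\<close>) places the top coefficient of the Wronskian at
  \<open>degree f + degree a\<close> without a truncated \<open>- 1\<close>.
\<close>

lemma degree_pCons_0_pderiv_le: "degree (pCons 0 (pderiv f)) \<le> degree (f :: complex poly)"
proof (cases "degree f")
  case 0
  then have "pderiv f = 0" by (simp add: pderiv_eq_0_iff)
  then show ?thesis by simp
next
  case (Suc k)
  then show ?thesis by (auto simp: degree_pCons_eq_if degree_pderiv)
qed

lemma coeff_pCons_0_pderiv: "coeff (pCons 0 (pderiv f)) k = of_nat k * coeff (f :: complex poly) k"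
  by (cases k) (auto simp: coeff_pderiv)

text \<open>\<open>pCons 0 (pderiv f)\<close> is the Euler operator applied to \<open>f\<close>: it
  multiplies the leading coefficient by the degree. Only a bound on the degree results, since the
  top terms cancel when \<open>s * degree a = p * degree f\<close>.\<close>

lemma wronskian_top_coeff:
  shows "degree (pCons 0 (wronskian s p f a)) \<le> degree f + degree a"
    and "coeff (pCons 0 (wronskian s p f a)) (degree f + degree a)
       = (of_nat s * of_nat (degree a) - of_nat p * of_nat (degree f)) * lead_coeff f * lead_coeff a"
proof -
  have eq: "pCons 0 (wronskian s p f a) = smult (of_nat s) (f * pCons 0 (pderiv a))
      - smult (of_nat p) (pCons 0 (pderiv f) * a)"
    by (simp add: wronskian_def of_nat_poly algebra_simps)
  have 1: "degree (f * pCons 0 (pderiv a)) \<le> degree f + degree a"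
    using degree_mult_le[of f "pCons 0 (pderiv a)"] degree_pCons_0_pderiv_le[of a] by linarith
  have 2: "degree (pCons 0 (pderiv f) * a) \<le> degree f + degree a"
    using degree_mult_le[of "pCons 0 (pderiv f)" a] degree_pCons_0_pderiv_le[of f] by linarith
  show "degree (pCons 0 (wronskian s p f a)) \<le> degree f + degree a"
    unfolding eq by (intro degree_diff_le order_trans[OF degree_smult_le] 1 2)
  have "coeff (f * pCons 0 (pderiv a)) (degree f + degree a)
      = lead_coeff f * coeff (pCons 0 (pderiv a)) (degree a)"
    by (intro coeff_mult_at_degree_bound degree_pCons_0_pderiv_le) simp
  moreover have "coeff (pCons 0 (pderiv f) * a) (degree f + degree a)
      = coeff (pCons 0 (pderiv f)) (degree f) * lead_coeff a"
    by (intro coeff_mult_at_degree_bound degree_pCons_0_pderiv_le) simp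
  ultimately show "coeff (pCons 0 (wronskian s p f a)) (degree f + degree a)
      = (of_nat s * of_nat (degree a) - of_nat p * of_nat (degree f)) * lead_coeff f * lead_coeff a"
    unfolding eq coeff_diff coeff_smult by (simp only: coeff_pCons_0_pderiv) (simp add: algebra_simps)
qed

section \<open>Vanishing Wronskians\<close>

lemma wronskian_0_imp_degree_eq:
  assumes "wronskian 1 1 f g = 0" "f \<noteq> 0" "g \<noteq> 0"
  shows "degree f = degree g"
proof -
  have "(of_nat (degree g) - of_nat (degree f)) * lead_coeff f * lead_coeff g = 0"
    using wronskian_top_coeff(2)[of 1 1 f g] assms(1) by simp
  with assms(2,3) show ?thesis by simp
qed

text \<open>Subtracting the multiple of \<open>g\<close> that kills the leading coefficient of
  \<open>f\<close> keeps the Wronskian zero. A nonzero difference would still have the degree of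
  \<open>g\<close>, where its coefficient is zero.\<close>

lemma wronskian_0_imp_proportional:
  assumes W: "wronskian 1 1 f g = 0" and f: "f \<noteq> 0" and g: "g \<noteq> 0"
  obtains \<kappa> where "\<kappa> \<noteq> 0" "f = smult \<kappa> g"
proof -
  define \<kappa> where "\<kappa> = lead_coeff f / lead_coeff g"
  define h where "h = f - smult \<kappa> g"
  have deg: "degree f = degree g" by (rule wronskian_0_imp_degree_eq) fact+
  have "wronskian 1 1 h g = wronskian 1 1 f g"
    by (simp add: wronskian_def h_def pderiv_diff pderiv_smult algebra_simps)
  then have Wh: "wronskian 1 1 h g = 0" using W by simp
  have "coeff h (degree g) = 0" using g deg by (simp add: h_def \<kappa>_def)
  then have "h = 0" using wronskian_0_imp_degree_eq[OF Wh _ g] by (metis leading_coeff_0_iff)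
  moreover have "\<kappa> \<noteq> 0" using f g by (simp add: \<kappa>_def)
  ultimately show ?thesis using that[of \<kappa>] by (simp add: h_def)
qed

lemma pderiv_pow_times:
  "f * pderiv (f ^ n) = of_nat n * f ^ n * pderiv (f :: complex poly)"
  by (induction n) (simp_all add: pderiv_mult algebra_simps)

text \<open>The weights are absorbed into exponents: up to nonzero factors, the weighted Wronskian
  of \<open>f\<close> and \<open>a\<close> is the plain one of \<open>f ^ p\<close> and
  \<open>a ^ s\<close>.\<close>

lemma wronskian_0_imp_power_proportional:
  assumes W: "wronskian s p f a = 0" and f: "f \<noteq> 0" and a: "a \<noteq> 0"
  obtains \<kappa> where "\<kappa> \<noteq> 0" "f ^ p = smult \<kappa> (a ^ s)"
proof -
  have "f * a * wronskian 1 1 (f ^ p) (a ^ s)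
      = f * f ^ p * (a * pderiv (a ^ s)) - a * a ^ s * (f * pderiv (f ^ p))"
    by (simp add: wronskian_def algebra_simps)
  also have "\<dots> = f ^ p * a ^ s * wronskian s p f a"
    by (simp add: pderiv_pow_times wronskian_def algebra_simps)
  finally have "wronskian 1 1 (f ^ p) (a ^ s) = 0" using W f a by simp
  from wronskian_0_imp_proportional[OF this] show ?thesis using that f a by auto
qed

text \<open>Generically the Wronskian vanishes at \<open>r\<close> to order
  \<open>order r f + order r a - 1\<close>; the hypothesis determines that order in terms of
  \<open>a\<close> alone, and excludes the exceptional case of a higher one.\<close>

lemma wronskian_order_at_root:
  assumes eq: "wronskian s p f a ^ p = smult \<kappa> (a ^ (s + p - 1))" and "\<kappa> \<noteq> 0"
    and p: "p > 0" and root: "poly a r = 0" and a: "a \<noteq> 0" and f: "f \<noteq> 0"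
  shows "p * order r f + order r a = p + s * order r a"
proof -
  define v e where "v = order r f" and "e = order r a"
  let ?x = "[:-r, 1:]"
  obtain u where u: "f = ?x ^ v * u" "\<not> ?x dvd u" using order_decomp[OF f] unfolding v_def by blast
  obtain w where w: "a = ?x ^ e * w" "\<not> ?x dvd w" using order_decomp[OF a] unfolding e_def by blast
  have e: "e > 0" using root a by (simp add: e_def order_root)
  \<comment> \<open>The extra factor \<open>?x\<close> compensates the order lost by
    differentiation, so that no exponent \<open>k - 1\<close> appears.\<close>
  have dx: "?x * pderiv (?x ^ k * h) = ?x ^ k * (of_nat k * h + ?x * pderiv h)" for k h
  proof -
    have "?x * pderiv (?x ^ k * h) = ?x ^ k * (?x * pderiv h) + h * (?x * pderiv (?x ^ k))"
      by (simp add: pderiv_mult algebra_simps del: mult_pCons_left mult_pCons_right)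
    also have "?x * pderiv (?x ^ k) = of_nat k * ?x ^ k"
      by (simp add: pderiv_pow_times pderiv_pCons del: mult_pCons_left mult_pCons_right)
    finally show ?thesis by (simp add: algebra_simps del: mult_pCons_left mult_pCons_right)
  qed
  \<comment> \<open>The cofactor of \<open>?x ^ (v + e)\<close> in
    \<open>?x * wronskian s p f a\<close>; its value at \<open>r\<close> is
    \<open>s * e - p * v\<close> times the nonzero number \<open>poly (u * w) r\<close>.\<close>
  define y where "y = (of_nat s * of_nat e - of_nat p * of_nat v) * (u * w)
      + ?x * wronskian s p u w"
  have "?x * wronskian s p f a = of_nat s * f * (?x * pderiv a) - of_nat p * a * (?x * pderiv f)"
    by (simp add: wronskian_def algebra_simps del: mult_pCons_left mult_pCons_right)
  also have "\<dots> = ?x ^ (v + e) * y"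
    unfolding u(1) w(1) dx y_def
    by (simp add: wronskian_def power_add algebra_simps
        del: mult_pCons_left mult_pCons_right)
  finally have xW: "?x * wronskian s p f a = ?x ^ (v + e) * y" .
  have W: "wronskian s p f a \<noteq> 0" using eq a \<open>\<kappa> \<noteq> 0\<close> p by (auto simp: power_0_left)
  then have y: "y \<noteq> 0" using xW by (metis mult_eq_0_iff mult_zero_right pCons_eq_0_iff zero_neq_one)
  have "order r (?x * wronskian s p f a) = 1 + order r (wronskian s p f a)"
  proof -
    have "?x * wronskian s p f a \<noteq> 0" unfolding mult_eq_0_iff using W by simp
    from order_mult[OF this] show ?thesis using order_power_n_n[of r 1] by simp
  qed
  moreover have "order r (?x ^ (v + e) * y) = v + e + order r y"
    using y by (subst order_mult) (auto simp: order_power_n_n)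
  ultimately have oW: "1 + order r (wronskian s p f a) = v + e + order r y" using xW by simp
  have "p * order r (wronskian s p f a) = order r (wronskian s p f a ^ p)"
    by (simp flip: count_proots add: W proots_power)
  also have "\<dots> = (s + p - 1) * e"
    unfolding eq using \<open>\<kappa> \<noteq> 0\<close> a by (simp add: order_smult e_def proots_power flip: count_proots)
  finally have key: "p * order r (wronskian s p f a) = (s + p - 1) * e" .
  have "p * (1 + order r (wronskian s p f a)) + e = p + (s + p) * e"
    using key p by (cases p) (auto simp: algebra_simps)
  then have key': "p * v + p * order r y + e = p + s * e" unfolding oW by (simp add: algebra_simps)
  \<comment> \<open>If \<open>y\<close> vanished at \<open>r\<close>, then
    \<open>s * e = p * v\<close>, and \<open>key'\<close> would read
    \<open>p * order r y + e = p\<close>, which is impossible for \<open>e > 0\<close>.\<close>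
  have "order r y = 0"
  proof (rule ccontr)
    assume "order r y \<noteq> 0"
    then have oy: "order r y \<ge> 1" by simp
    then have "?x dvd y" by (simp add: order_root flip: poly_eq_0_iff_dvd)
    then have "?x dvd (of_nat s * of_nat e - of_nat p * of_nat v) * (u * w)"
      unfolding y_def by (metis dvd_add_left_iff dvd_triv_left)
    then have "poly ((of_nat s * of_nat e - of_nat p * of_nat v) * (u * w)) r = 0"
      by (simp only: poly_eq_0_iff_dvd)
    moreover have "poly u r \<noteq> 0" "poly w r \<noteq> 0" using u(2) w(2) by (simp_all add: poly_eq_0_iff_dvd)
    ultimately have "(of_nat s * of_nat e :: complex) = of_nat p * of_nat v"
      by (auto simp: of_nat_poly mult.commute)
    then have se: "s * e = p * v" by (metis of_nat_eq_iff of_nat_mult)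
    have "p \<le> p * order r y" using oy p by simp
    with key' se e show False by linarith
  qed
  with key' show ?thesis by (simp add: v_def e_def mult.commute)
qed

text \<open>The same count at infinity, with degrees for orders. Cancellation of the top terms would
  force \<open>2 * p \<le> degree a\<close>, against \<open>degree a < p\<close>.\<close>

lemma wronskian_degree:
  assumes eq: "wronskian s p f a ^ p = smult \<kappa> (a ^ (s + p - 1))" and "\<kappa> \<noteq> 0"
    and p: "degree a < p" and f: "f \<noteq> 0" and a: "a \<noteq> 0"
  shows "p * degree f + degree a = p + s * degree a"
proof -
  let ?W = "wronskian s p f a"
  have W: "?W \<noteq> 0" using eq a \<open>\<kappa> \<noteq> 0\<close> p by (auto simp: power_0_left)
  have "p * degree ?W = degree (?W ^ p)" using W by (simp add: degree_power_eq)
  also have "\<dots> = (s + p - 1) * degree a" unfolding eq using \<open>\<kappa> \<noteq> 0\<close> a by (simp add: degree_power_eq)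
  finally have key: "p * degree ?W = (s + p - 1) * degree a" .
  have key': "p * (1 + degree ?W) + degree a = p + (s + p) * degree a"
    using key p by (cases p) (auto simp: algebra_simps)
  have le: "1 + degree ?W \<le> degree f + degree a"
    using wronskian_top_coeff(1)[of s p f a] W by simp
  have "1 + degree ?W = degree f + degree a"
  proof (rule ccontr)
    assume "1 + degree ?W \<noteq> degree f + degree a"
    then have lt: "1 + degree ?W < degree f + degree a" using le by simp
    then have "coeff (pCons 0 ?W) (degree f + degree a) = 0" using W by (intro coeff_eq_0) simp
    then have "(of_nat s * of_nat (degree a) :: complex) = of_nat p * of_nat (degree f)"
      using f a unfolding wronskian_top_coeff(2) by simp
    then have sd: "s * degree a = p * degree f" by (metis of_nat_eq_iff of_nat_mult)
    have "p * (2 + degree ?W) \<le> p * (degree f + degree a)" using lt by (intro mult_le_mono2) simp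
    with key' sd p show False by (simp add: algebra_simps)
  qed
  note key'[unfolded this]
  then show ?thesis by (simp add: algebra_simps)
qed

text \<open>The local identities, summed over the roots of \<open>a\<close>, contribute
  \<open>p\<close> once per root; the degree identity contributes it once. A zero of
  \<open>f\<close> outside the roots of \<open>a\<close> would leave room for no root of
  \<open>a\<close> at all, but \<open>a\<close> is not constant.\<close>

lemma wronskian_power_imp_nonzero_at_0:
  assumes eq: "wronskian s p f a ^ p = smult \<kappa> (a ^ (s + p - 1))" and \<kappa>: "\<kappa> \<noteq> 0"
    and a0: "poly a 0 \<noteq> 0" and p: "degree a < p" and dega: "degree a > 0"
  shows "poly f 0 \<noteq> 0"
proof
  assume f0: "poly f 0 = 0"
  have a: "a \<noteq> 0" using a0 by auto
  have f: "f \<noteq> 0"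
  proof
    assume "f = 0"
    then have "smult \<kappa> (a ^ (s + p - 1)) = 0" using eq p by (simp add: wronskian_def power_0_left)
    then show False using \<kappa> a by simp
  qed
  let ?R = "{r. poly a r = 0}"
  have fin: "finite ?R" using a by (rule poly_roots_finite)
  have "?R \<noteq> {}" using dega fundamental_theorem_of_algebra[of a]
    by (auto simp: constant_degree)
  then have card: "card ?R \<ge> 1" using fin by (simp add: card_gt_0_iff Suc_leI)
  have "degree a = size (proots a)" by (simp add: size_proots_complex)
  also have "\<dots> = (\<Sum>r\<in>?R. order r a)"
    using a by (simp add: size_multiset_overloaded_eq)
  finally have da: "degree a = (\<Sum>r\<in>?R. order r a)" .
  \<comment> \<open>Roots of \<open>a\<close> need not be roots of \<open>f\<close>; passing through
    the union is harmless, as the added terms have order zero.\<close>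
  have "(\<Sum>r\<in>insert 0 ?R. order r f) \<le> (\<Sum>r\<in>insert 0 ?R \<union> {r. poly f r = 0}. order r f)"
    using fin poly_roots_finite[OF f] by (intro sum_mono2) auto
  also have "\<dots> = (\<Sum>r | poly f r = 0. order r f)"
    using fin poly_roots_finite[OF f] by (intro sum.mono_neutral_right) (auto simp: order_root f)
  also have "\<dots> \<le> degree f" using f by (rule sum_order_le_degree)
  finally have "order 0 f + (\<Sum>r\<in>?R. order r f) \<le> degree f" using a0 fin by simp
  moreover have "order 0 f \<ge> 1" using f0 f by (simp add: order_root Suc_leI)
  ultimately have "p * (1 + (\<Sum>r\<in>?R. order r f)) \<le> p * degree f" by (intro mult_le_mono2) simp
  then have "p + (\<Sum>r\<in>?R. p * order r f) + degree a \<le> p + s * degree a"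
    using wronskian_degree[OF eq \<kappa> p f a] by (simp add: sum_distrib_left)
  moreover have "(\<Sum>r\<in>?R. p * order r f + order r a) = (\<Sum>r\<in>?R. p + s * order r a)"
    using wronskian_order_at_root[OF eq \<kappa> _ _ a f] p by (intro sum.cong) auto
  ultimately have "p * card ?R \<le> 0"
    by (auto simp: sum.distrib da sum_distrib_left)
  with p card show False by simp
qed

section \<open>Symbols in the Weyl algebra\<close>

lemma coeff_d_left:
  "coeff (d_left Q) i = coeff (pCons 0 Q) i + pderiv (coeff Q i)"
  by (simp add: d_left_def coeff_map_poly)

lemma degree_d_left_pow_le:
  assumes "degree Q \<le> k"
  shows "degree ((d_left ^^ j) Q) \<le> j + k"
proof (induction j)
  case (Suc j)
  show ?case
    by (rule degree_le) (use Suc in \<open>auto simp: coeff_d_left coeff_pCons coeff_eq_0 split: nat.split\<close>)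
qed (use assms in simp)

lemma coeff_d_left_pow_top:
  assumes "degree Q \<le> k"
  shows "coeff ((d_left ^^ j) Q) (j + k) = coeff Q k"
proof (induction j)
  case (Suc j)
  have "coeff ((d_left ^^ j) Q) (Suc (j + k)) = 0"
    using degree_d_left_pow_le[OF assms, of j] by (simp add: coeff_eq_0)
  with Suc show ?case by (simp add: coeff_d_left)
qed simp

text \<open>Prepending a zero makes index \<open>j + k\<close> refer to the coefficient just below
  the top without a truncated subtraction. Each application of \<open>d_left\<close> adds one
  derivative of the constant top coefficient.\<close>

lemma coeff_d_left_pow_subtop:
  assumes "degree Q \<le> k"
  shows "coeff (pCons 0 ((d_left ^^ j) Q)) (j + k)
       = coeff (pCons 0 Q) k + of_nat j * pderiv (coeff Q k)"
  by (induction j) (simp_all add: coeff_d_left coeff_d_left_pow_top[OF assms] algebra_simps)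

text \<open>The symbol \<open>f\<close> may be \<open>0\<close>; only for \<open>f \<noteq> 0\<close> is \<open>k\<close> the order of \<open>X\<close>.\<close>

definition has_symbol :: "weyl \<Rightarrow> nat \<Rightarrow> complex poly \<Rightarrow> bool" where
  "has_symbol X k f \<longleftrightarrow> degree (Rep_weyl X) \<le> k \<and> coeff (Rep_weyl X) k = f"

text \<open>The first two terms of the composition formula for symbols. Only the summands for
  \<open>j\<close> and \<open>j - 1\<close> reach these degrees.\<close>

lemma normal_mult_top_coeffs:
  assumes X: "degree X \<le> j" and Y: "degree Y \<le> k"
  shows "degree (normal_mult X Y) \<le> j + k"
    and "coeff (normal_mult X Y) (j + k) = coeff X j * coeff Y k"
    and "coeff (pCons 0 (normal_mult X Y)) (j + k)
       = coeff X j * coeff (pCons 0 Y) k + coeff (pCons 0 X) j * coeff Y k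
         + of_nat j * coeff X j * pderiv (coeff Y k)"
proof -
  have eq: "normal_mult X Y = (\<Sum>i\<le>j. smult (coeff X i) ((d_left ^^ i) Y))"
    using X by (rule normal_mult_bound)
  have deg: "degree ((d_left ^^ i) Y) \<le> i + k" for i by (rule degree_d_left_pow_le[OF Y])
  show "degree (normal_mult X Y) \<le> j + k"
    unfolding eq
  proof (rule degree_sum_le)
    show "degree (smult (coeff X i) ((d_left ^^ i) Y)) \<le> j + k" if "i \<in> {..j}" for i
      using that deg[of i] degree_smult_le[of "coeff X i" "(d_left ^^ i) Y"] by simp
  qed simp
  have "coeff (normal_mult X Y) (j + k) = (\<Sum>i\<le>j. coeff X i * coeff ((d_left ^^ i) Y) (j + k))"
    by (simp add: eq coeff_sum)
  also have "\<dots> = (\<Sum>i\<in>{j}. coeff X i * coeff ((d_left ^^ i) Y) (j + k))"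
  proof (rule sum.mono_neutral_right)
    show "\<forall>i\<in>{..j} - {j}. coeff X i * coeff ((d_left ^^ i) Y) (j + k) = 0"
      using deg by (auto intro!: coeff_eq_0 le_less_trans[OF deg])
  qed auto
  finally show "coeff (normal_mult X Y) (j + k) = coeff X j * coeff Y k"
    by (simp add: coeff_d_left_pow_top[OF Y])
  show "coeff (pCons 0 (normal_mult X Y)) (j + k)
       = coeff X j * coeff (pCons 0 Y) k + coeff (pCons 0 X) j * coeff Y k
         + of_nat j * coeff X j * pderiv (coeff Y k)"
  proof (cases j)
    case 0
    then show ?thesis by (cases k) (simp_all add: eq)
  next
    case (Suc j')
    have "coeff (pCons 0 (normal_mult X Y)) (j + k)
        = (\<Sum>i\<le>j. coeff X i * coeff ((d_left ^^ i) Y) (j' + k))"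
      by (simp add: eq coeff_sum Suc)
    also have "\<dots> = (\<Sum>i\<in>{j', j}. coeff X i * coeff ((d_left ^^ i) Y) (j' + k))"
    proof (rule sum.mono_neutral_right)
      show "\<forall>i\<in>{..j} - {j', j}. coeff X i * coeff ((d_left ^^ i) Y) (j' + k) = 0"
        using deg Suc by (auto intro!: coeff_eq_0 le_less_trans[OF deg])
    qed (auto simp: Suc)
    also have "\<dots> = coeff X j' * coeff Y k + coeff X j * coeff (pCons 0 ((d_left ^^ j) Y)) (j + k)"
      by (simp add: Suc coeff_d_left_pow_top[OF Y] del: funpow.simps)
    also have "\<dots> = coeff X j * coeff (pCons 0 Y) k + coeff (pCons 0 X) j * coeff Y k
         + of_nat j * coeff X j * pderiv (coeff Y k)"
      unfolding coeff_d_left_pow_subtop[OF Y] by (simp add: Suc algebra_simps)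
    finally show ?thesis .
  qed
qed

lemma has_symbol_mult:
  "has_symbol X j f \<Longrightarrow> has_symbol Y k g \<Longrightarrow> has_symbol (X * Y) (j + k) (f * g)"
  by (auto simp: has_symbol_def times_weyl.rep_eq normal_mult_top_coeffs)

lemma has_symbol_1: "has_symbol 1 0 1"
  by (simp add: has_symbol_def one_weyl.rep_eq)

lemma has_symbol_power: "has_symbol X j f \<Longrightarrow> has_symbol (X ^ n) (n * j) (f ^ n)"
  by (induction n) (auto simp: has_symbol_1 has_symbol_mult)

lemma has_symbol_add:
  "has_symbol X k f \<Longrightarrow> has_symbol Y k g \<Longrightarrow> has_symbol (X + Y) k (f + g)"
  by (auto simp: has_symbol_def plus_weyl.rep_eq intro: degree_add_le)

lemma has_symbol_diff:
  "has_symbol X k f \<Longrightarrow> has_symbol Y k g \<Longrightarrow> has_symbol (X - Y) k (f - g)"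
  by (auto simp: has_symbol_def minus_weyl.rep_eq intro: degree_diff_le)

lemma has_symbol_scale: "has_symbol X k f \<Longrightarrow> has_symbol (weyl_scale c X) k (smult c f)"
  by (auto simp: has_symbol_def weyl_scale.rep_eq intro: order_trans[OF degree_smult_le])

lemma degree_eq_has_symbol: "has_symbol X k f \<Longrightarrow> f \<noteq> 0 \<Longrightarrow> degree (Rep_weyl X) = k"
  by (auto simp: has_symbol_def intro: antisym le_degree)

section \<open>Commutators and their symbols\<close>

definition commutator :: "weyl \<Rightarrow> weyl \<Rightarrow> weyl" where
  "commutator X Y = X * Y - Y * X"

text \<open>Coefficients in \<open>x\<close> commute, so the top terms cancel, and one degree lower
  only the two derivative terms survive.\<close>

lemma has_symbol_commutator:
  assumes "has_symbol X j f" "has_symbol Y k g" "j + k > 0"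
  shows "has_symbol (commutator X Y) (j + k - 1) (wronskian j k f g)"
proof -
  let ?X = "Rep_weyl X" and ?Y = "Rep_weyl Y"
  let ?C = "normal_mult ?X ?Y - normal_mult ?Y ?X"
  have X: "degree ?X \<le> j" "coeff ?X j = f" and Y: "degree ?Y \<le> k" "coeff ?Y k = g"
    using assms by (auto simp: has_symbol_def)
  note XY = normal_mult_top_coeffs[OF X(1) Y(1)]
  note YX = normal_mult_top_coeffs[OF Y(1) X(1), unfolded add.commute[of k j]]
  obtain r where r: "j + k = Suc r" using assms(3) by (cases "j + k") auto
  have deg: "degree ?C \<le> j + k" by (intro degree_diff_le XY(1) YX(1))
  have top: "coeff ?C (j + k) = 0" by (simp add: XY(2) YX(2))
  have "degree ?C \<le> r"
  proof (rule degree_le, intro allI impI)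
    fix i assume "r < i"
    then consider "i = j + k" | "j + k < i" using r by linarith
    then show "coeff ?C i = 0"
      by cases (use top deg in \<open>auto simp del: coeff_diff intro: coeff_eq_0\<close>)
  qed
  moreover have "coeff ?C r = coeff (pCons 0 ?C) (j + k)" by (simp add: r)
  moreover have "coeff (pCons 0 ?C) (j + k)
      = coeff (pCons 0 (normal_mult ?X ?Y)) (j + k) - coeff (pCons 0 (normal_mult ?Y ?X)) (j + k)"
    by (simp add: r)
  moreover have "\<dots> = wronskian j k f g"
    unfolding XY(3) YX(3) X(2) Y(2) wronskian_def by (simp add: algebra_simps)
  ultimately show ?thesis
    by (simp add: has_symbol_def commutator_def minus_weyl.rep_eq times_weyl.rep_eq r)
qed

lemma weyl_scale_mult_left: "weyl_scale c X * Y = weyl_scale c (X * Y)"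
  by transfer (rule normal_mult_smult_left)

lemma weyl_scale_mult_right: "X * weyl_scale c Y = weyl_scale c (X * Y)"
proof -
  have "(d_left ^^ j) (smult [:c:] Z) = smult [:c:] ((d_left ^^ j) Z)" for j Z
    by (induction j) (simp_all add: d_left_smult)
  then have "normal_mult Z (smult [:c:] Y) = smult [:c:] (normal_mult Z Y)" for Z Y
    unfolding normal_mult_def smult_sum_poly by (simp add: mult.commute)
  then show ?thesis by transfer
qed

text \<open>Used with \<open>Y = P\<close>: the subtraction in the recursion leaves the commutator
  with \<open>P\<close> unchanged, so only the powers taken influence it.\<close>

lemma commutator_diff_scale_power:
  "commutator (X - weyl_scale c (Y ^ m)) Y = commutator X Y"
  by (simp add: commutator_def algebra_simps weyl_scale_mult_left weyl_scale_mult_right power_commutes)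

text \<open>By the Leibniz rule the commutator is a sum of \<open>Suc n\<close> products.
  \<open>F\<close> and \<open>commutator F P\<close> need not commute, but their symbols do, so all
  summands have the same symbol.\<close>

lemma has_symbol_commutator_power:
  assumes F: "has_symbol F s f" and B: "has_symbol (commutator F P) b w"
  shows "has_symbol (commutator (F ^ Suc n) P) (n * s + b) (of_nat (Suc n) * f ^ n * w)"
proof (induction n)
  case (Suc n)
  have "commutator (F ^ Suc (Suc n)) P = F * commutator (F ^ Suc n) P + commutator F P * F ^ Suc n"
    by (simp add: commutator_def algebra_simps)
  moreover have "has_symbol (F * commutator (F ^ Suc n) P) (Suc n * s + b)
      (f * (of_nat (Suc n) * f ^ n * w))"
    using has_symbol_mult[OF F Suc] by (simp add: add_ac)
  moreover have "has_symbol (commutator F P * F ^ Suc n) (Suc n * s + b) (w * f ^ Suc n)"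
    using has_symbol_mult[OF B has_symbol_power[OF F, of "Suc n"]] by (simp add: add_ac)
  ultimately have "has_symbol (commutator (F ^ Suc (Suc n)) P) (Suc n * s + b)
      (f * (of_nat (Suc n) * f ^ n * w) + w * f ^ Suc n)"
    by (simp add: has_symbol_add)
  then show ?case by (simp add: algebra_simps)
qed (use B in simp)

section \<open>Orders and highest monomials read off the normal form\<close>

lemma finite_weyl_supp: "finite (weyl_supp X)"
proof -
  let ?X = "Rep_weyl X"
  have "weyl_supp X \<subseteq> (\<Union>j\<le>degree ?X. (\<lambda>i. (i, j)) ` {..degree (coeff ?X j)})"
  proof
    fix z assume "z \<in> weyl_supp X"
    then obtain i j where z: "z = (i, j)" "coeff (coeff ?X j) i \<noteq> 0"
      by (auto simp: weyl_supp_def weyl_coeff.rep_eq)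
    then have "coeff ?X j \<noteq> 0" by auto
    with z show "z \<in> (\<Union>j\<le>degree ?X. (\<lambda>i. (i, j)) ` {..degree (coeff ?X j)})"
      by (auto intro!: bexI[of _ j] imageI le_degree)
  qed
  then show ?thesis by (rule finite_subset) auto
qed

lemma weyl_ord_eq_degree:
  assumes "X \<noteq> 0"
  shows "weyl_ord X = degree (Rep_weyl X)"
proof -
  let ?X = "Rep_weyl X"
  have "?X \<noteq> 0" using assms by (metis Rep_weyl_inject zero_weyl.rep_eq)
  then obtain i where "coeff (coeff ?X (degree ?X)) i \<noteq> 0"
    by (metis leading_coeff_0_iff poly_eqI coeff_0)
  then have "degree ?X \<in> (\<lambda>(i, j). j) ` weyl_supp X"
    by (force simp: weyl_supp_def weyl_coeff.rep_eq image_iff)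
  moreover have "j \<le> degree ?X" if "(i, j) \<in> weyl_supp X" for i j
    using that by (auto simp: weyl_supp_def weyl_coeff.rep_eq intro!: le_degree)
  ultimately show ?thesis
    unfolding weyl_ord_def by (intro Max_eqI) (auto simp: finite_weyl_supp)
qed

text \<open>In the support \<open>j - i\<close> is at most the order, with equality only at
  \<open>i = 0\<close> and \<open>j\<close> the order; that point is present if the symbol does not
  vanish at 0.\<close>

lemma weyl_bold_ord_eq_degree:
  assumes "poly (lead_coeff (Rep_weyl X)) 0 \<noteq> 0"
  shows "weyl_bold_ord X = int (degree (Rep_weyl X))"
proof -
  let ?X = "Rep_weyl X"
  have "(0, degree ?X) \<in> weyl_supp X"
    using assms by (simp add: weyl_supp_def weyl_coeff.rep_eq poly_0_coeff_0)
  then have "int (degree ?X) \<in> (\<lambda>(i, j). int j - int i) ` weyl_supp X" by force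
  moreover have "j \<le> degree ?X" if "(i, j) \<in> weyl_supp X" for i j
    using that by (auto simp: weyl_supp_def weyl_coeff.rep_eq intro!: le_degree)
  then have "int j - int i \<le> int (degree ?X)" if "(i, j) \<in> weyl_supp X" for i j
    using that by force
  ultimately show ?thesis
    unfolding weyl_bold_ord_def by (intro Max_eqI) (auto simp: finite_weyl_supp)
qed

lemma weyl_ord_eq_bold_ord_imp:
  assumes "X \<noteq> 0" "int (weyl_ord X) = weyl_bold_ord X"
  shows "poly (lead_coeff (Rep_weyl X)) 0 \<noteq> 0"
proof -
  let ?X = "Rep_weyl X"
  have "weyl_supp X \<noteq> {}"
  proof
    assume "weyl_supp X = {}"
    then have "Rep_weyl X = 0" by (intro poly_eqI) (auto simp: weyl_supp_def weyl_coeff.rep_eq)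
    then show False using assms(1) by (metis Rep_weyl_inject zero_weyl.rep_eq)
  qed
  then have "weyl_bold_ord X \<in> (\<lambda>(i, j). int j - int i) ` weyl_supp X"
    unfolding weyl_bold_ord_def by (intro Max_in) (auto simp: finite_weyl_supp)
  then obtain i j where ij: "(i, j) \<in> weyl_supp X" "int (degree ?X) = int j - int i"
    using assms by (auto simp: weyl_ord_eq_degree)
  moreover have "j \<le> degree ?X"
    using ij(1) by (auto simp: weyl_supp_def weyl_coeff.rep_eq intro!: le_degree)
  ultimately have "i = 0" "j = degree ?X" by auto
  then show ?thesis
    using ij(1) by (simp add: weyl_supp_def weyl_coeff.rep_eq poly_0_coeff_0)
qed

text \<open>An extreme point of a convex hull belongs to the generating set, so
  \<open>(l, k)\<close> is itself in the support and dominates it in both coordinates.\<close>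

lemma has_Hm_imp:
  assumes "has_Hm X l k"
  shows "weyl_ord X = k" "weyl_ord_x X = l" "degree (lead_coeff (Rep_weyl X)) = l"
proof -
  let ?X = "Rep_weyl X" and ?S = "(\<lambda>(i, j). (real i, real j)) ` weyl_supp X"
  have X: "X \<noteq> 0" and ex: "(real l, real k) extreme_point_of convex hull ?S"
    and sub: "convex hull ?S \<subseteq> {0..real l} \<times> {0..real k}"
    using assms by (auto simp: has_Hm_def newton_polygon_def)
  from extreme_point_of_convex_hull[OF ex] have lk: "(l, k) \<in> weyl_supp X" by auto
  have le: "i \<le> l \<and> j \<le> k" if "(i, j) \<in> weyl_supp X" for i j
  proof -
    have "(real i, real j) \<in> convex hull ?S" using that by (force intro: hull_inc)
    with sub show ?thesis by auto
  qed
  show o: "weyl_ord X = k"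
    unfolding weyl_ord_def using lk le
    by (intro Max_eqI) (auto simp: finite_weyl_supp image_iff intro!: bexI[of _ "(l, k)"])
  show "weyl_ord_x X = l"
    unfolding weyl_ord_x_def using lk le
    by (intro Max_eqI) (auto simp: finite_weyl_supp image_iff intro!: bexI[of _ "(l, k)"])
  have k: "degree ?X = k" using o X by (simp add: weyl_ord_eq_degree)
  show "degree (lead_coeff ?X) = l"
  proof (rule antisym)
    show "degree (lead_coeff ?X) \<le> l"
      by (rule degree_le)
         (use le[of _ "degree ?X"] in \<open>force simp: weyl_supp_def weyl_coeff.rep_eq\<close>)
    show "l \<le> degree (lead_coeff ?X)"
      using lk k by (intro le_degree) (simp add: weyl_supp_def weyl_coeff.rep_eq)
  qed
qed

section \<open>Coefficient fields\<close>

lemma is_subfield_coeff_field: "is_subfield (coeff_field P Q)"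
  unfolding coeff_field_def by (rule hull_in) (auto simp: is_subfield_def)

lemma
  assumes "is_subfield K"
  shows subfield_0: "0 \<in> K" and subfield_1: "1 \<in> K"
    and subfield_diff: "x \<in> K \<Longrightarrow> y \<in> K \<Longrightarrow> x - y \<in> K"
    and subfield_mult: "x \<in> K \<Longrightarrow> y \<in> K \<Longrightarrow> x * y \<in> K"
    and subfield_inverse: "x \<in> K \<Longrightarrow> inverse x \<in> K"
  using assms by (auto simp: is_subfield_def)

lemma subfield_add:
  assumes "is_subfield K" "x \<in> K" "y \<in> K"
  shows "x + y \<in> K"
proof -
  have "x - (0 - y) \<in> K" using assms by (intro subfield_diff subfield_0)
  then show ?thesis by simp
qed

lemma subfield_sum: "is_subfield K \<Longrightarrow> (\<And>i. i \<in> A \<Longrightarrow> f i \<in> K) \<Longrightarrow> sum f A \<in> K"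
  by (induction A rule: infinite_finite_induct) (auto intro: subfield_add subfield_0)

lemma subfield_of_nat: "is_subfield K \<Longrightarrow> of_nat k \<in> K"
  by (induction k) (auto intro: subfield_add subfield_0 subfield_1)

lemma subfield_power: "is_subfield K \<Longrightarrow> x \<in> K \<Longrightarrow> x ^ k \<in> K"
  by (induction k) (auto intro: subfield_mult subfield_1)

lemma subfield_divide: "is_subfield K \<Longrightarrow> x \<in> K \<Longrightarrow> y \<in> K \<Longrightarrow> x / y \<in> K"
  unfolding divide_inverse by (intro subfield_mult subfield_inverse)

context
  fixes K :: "complex set"
  assumes K: "is_subfield K"
begin

lemma coeff_mult_in_subfield:
  assumes "\<And>i. coeff f i \<in> K" "\<And>i. coeff g i \<in> K"
  shows "coeff (f * g) i \<in> K"
  unfolding coeff_mult by (intro subfield_sum subfield_mult K assms)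

lemma bipoly_over_1: "1 \<in> bipoly_over K"
  by (auto simp: bipoly_over_def one_pCons coeff_pCons subfield_0[OF K] subfield_1[OF K] split: nat.split)

lemma bipoly_over_diff: "F \<in> bipoly_over K \<Longrightarrow> G \<in> bipoly_over K \<Longrightarrow> F - G \<in> bipoly_over K"
  by (auto simp: bipoly_over_def intro: subfield_diff K)

lemma bipoly_over_smult_const: "c \<in> K \<Longrightarrow> F \<in> bipoly_over K \<Longrightarrow> smult [:c:] F \<in> bipoly_over K"
  by (auto simp: bipoly_over_def intro: subfield_mult K)

lemma bipoly_over_mult:
  assumes "F \<in> bipoly_over K" "G \<in> bipoly_over K"
  shows "F * G \<in> bipoly_over K"
  unfolding bipoly_over_def
proof (intro CollectI allI)
  fix i j
  show "coeff (coeff (F * G) j) i \<in> K"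
    unfolding coeff_mult[of F] coeff_sum
    by (intro subfield_sum coeff_mult_in_subfield K) (use assms in \<open>auto simp: bipoly_over_def\<close>)
qed

lemma bipoly_over_power: "F \<in> bipoly_over K \<Longrightarrow> F ^ k \<in> bipoly_over K"
  by (induction k) (auto intro: bipoly_over_mult bipoly_over_1)

lemma F_poly_in_bipoly_over:
  assumes "\<And>j. j < i \<Longrightarrow> \<epsilon> j \<in> K"
  shows "F_poly ns ms \<epsilon> i \<in> bipoly_over K"
  using assms
proof (induction i)
  case 0
  then show ?case
    by (auto simp: bipoly_over_def one_pCons coeff_pCons subfield_0[OF K] subfield_1[OF K] split: nat.split)
next
  case (Suc i)
  have "[:[:0, 1:]:] \<in> bipoly_over K"
    by (auto simp: bipoly_over_def coeff_pCons subfield_0[OF K] subfield_1[OF K] split: nat.split)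
  with Suc show ?case
    by (auto intro!: bipoly_over_diff bipoly_over_smult_const bipoly_over_power subfield_power K)
qed

text \<open>Differentiation multiplies coefficients by natural numbers only, and these lie in
  \<open>K\<close>.\<close>

lemma bipoly_over_d_left:
  assumes "F \<in> bipoly_over K"
  shows "d_left F \<in> bipoly_over K"
  unfolding bipoly_over_def
proof (intro CollectI allI)
  fix i j
  have F: "coeff (coeff F j) i \<in> K" for i j using assms by (simp add: bipoly_over_def)
  have "coeff (coeff (pCons 0 F) j) i \<in> K"
    using F by (cases j) (auto simp: subfield_0[OF K])
  then show "coeff (coeff (d_left F) j) i \<in> K"
    unfolding coeff_d_left coeff_add coeff_pderiv
    by (intro subfield_add subfield_mult subfield_of_nat K F)
qed

lemma bipoly_over_normal_mult:
  assumes "F \<in> bipoly_over K" "G \<in> bipoly_over K"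
  shows "normal_mult F G \<in> bipoly_over K"
  unfolding bipoly_over_def
proof (intro CollectI allI)
  fix i j
  have "(d_left ^^ r) G \<in> bipoly_over K" for r
    by (induction r) (auto intro: assms bipoly_over_d_left)
  then show "coeff (coeff (normal_mult F G) j) i \<in> K"
    unfolding normal_mult_def coeff_sum coeff_smult
    by (intro subfield_sum coeff_mult_in_subfield K) (use assms in \<open>auto simp: bipoly_over_def\<close>)
qed

definition weyl_over :: "weyl set" where
  "weyl_over = {X. Rep_weyl X \<in> bipoly_over K}"

lemma weyl_over_diff: "X \<in> weyl_over \<Longrightarrow> Y \<in> weyl_over \<Longrightarrow> X - Y \<in> weyl_over"
  by (simp add: weyl_over_def minus_weyl.rep_eq bipoly_over_diff)

lemma weyl_over_power: "X \<in> weyl_over \<Longrightarrow> X ^ k \<in> weyl_over"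
  by (induction k) (auto simp: weyl_over_def one_weyl.rep_eq times_weyl.rep_eq
      bipoly_over_1 bipoly_over_normal_mult)

lemma weyl_over_scale: "c \<in> K \<Longrightarrow> X \<in> weyl_over \<Longrightarrow> weyl_scale c X \<in> weyl_over"
  by (simp add: weyl_over_def weyl_scale.rep_eq bipoly_over_smult_const)

end

lemma weyl_over_coeff_field: "P \<in> weyl_over (coeff_field P Q)" "Q \<in> weyl_over (coeff_field P Q)"
proof -
  let ?S = "{weyl_coeff P i j |i j. (i, j) \<in> weyl_supp P} \<union>
        {weyl_coeff Q i j |i j. (i, j) \<in> weyl_supp Q}"
  have sub: "?S \<subseteq> coeff_field P Q" unfolding coeff_field_def by (rule hull_subset)
  have 0: "0 \<in> coeff_field P Q" by (rule subfield_0[OF is_subfield_coeff_field])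
  have "weyl_coeff P i j \<in> coeff_field P Q" for i j
  proof (cases "weyl_coeff P i j = 0")
    case False
    then have "weyl_coeff P i j \<in> ?S" by (auto simp: weyl_supp_def)
    with sub show ?thesis by blast
  qed (use 0 in simp)
  then show "P \<in> weyl_over (coeff_field P Q)"
    by (simp add: weyl_over_def[OF is_subfield_coeff_field] bipoly_over_def weyl_coeff.rep_eq)
  have "weyl_coeff Q i j \<in> coeff_field P Q" for i j
  proof (cases "weyl_coeff Q i j = 0")
    case False
    then have "weyl_coeff Q i j \<in> ?S" by (auto simp: weyl_supp_def)
    with sub show ?thesis by blast
  qed (use 0 in simp)
  then show "Q \<in> weyl_over (coeff_field P Q)"
    by (simp add: weyl_over_def[OF is_subfield_coeff_field] bipoly_over_def weyl_coeff.rep_eq)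
qed

section \<open>The recursion\<close>

abbreviation ord :: "weyl \<Rightarrow> nat" where
  "ord X \<equiv> degree (Rep_weyl X)"

abbreviation symbol :: "weyl \<Rightarrow> complex poly" where
  "symbol X \<equiv> lead_coeff (Rep_weyl X)"

lemma has_symbol_symbol: "has_symbol X (ord X) (symbol X)"
  by (simp add: has_symbol_def)

lemma Rep_weyl_eq_0_iff: "Rep_weyl X = 0 \<longleftrightarrow> X = 0"
  by (metis Rep_weyl_inject zero_weyl.rep_eq)

lemma symbol_eq_0_iff: "symbol X = 0 \<longleftrightarrow> X = 0"
  by (simp add: Rep_weyl_eq_0_iff)

lemma ord_symbol_eqI: "has_symbol X k f \<Longrightarrow> f \<noteq> 0 \<Longrightarrow> ord X = k \<and> symbol X = f"
  using degree_eq_has_symbol by (auto simp: has_symbol_def)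

lemma commutator_0_left [simp]: "commutator 0 Y = 0"
  by (simp add: commutator_def)

lemma commutator_constant:
  assumes "Rep_weyl X = [:[:c:]:]"
  shows "commutator X Y = 0"
proof -
  have "X = weyl_scale c 1"
    using assms by (simp add: weyl_scale.rep_eq one_weyl.rep_eq one_pCons flip: Rep_weyl_inject)
  then show ?thesis by (simp add: commutator_def weyl_scale_mult_left weyl_scale_mult_right)
qed

text \<open>The condition at 0 encodes the equality of the two orders of \<open>P\<close>; the
  degree conditions encode \<open>Hm(P)\<close> together with \<open>l < d\<close>.\<close>

locale dixmier_pair =
  fixes P Q :: weyl and K :: "complex set"
  assumes commutator_Q_P: "commutator Q P = 1"
    and subfield: "is_subfield K"
    and P_over: "P \<in> weyl_over K" and Q_over: "Q \<in> weyl_over K"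
    and symbol_P_at_0: "poly (symbol P) 0 \<noteq> 0"
    and symbol_P_degree: "degree (symbol P) > 0" "degree (symbol P) < ord P"
begin

text \<open>The invariant of the recursion: up to a constant, the symbol of the commutator is the
  symbol of \<open>P\<close> raised to the quotient of the orders, stated without fractional
  exponents.\<close>

definition tame :: "weyl \<Rightarrow> bool" where
  "tame F \<longleftrightarrow> F \<in> weyl_over K \<and> commutator F P \<noteq> 0 \<and>
     (\<exists>\<kappa>. \<kappa> \<noteq> 0 \<and> symbol (commutator F P) ^ ord P = smult \<kappa> (symbol P ^ ord (commutator F P)))"

text \<open>For tame \<open>F\<close> this says that the Wronskian of the symbols is nonzero. The
  recursion stops there.\<close>

definition generic :: "weyl \<Rightarrow> bool" where
  "generic F \<longleftrightarrow> ord (commutator F P) = ord F + ord P - 1"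

lemma ord_P_pos: "ord P > 0"
  using symbol_P_degree by simp

lemma symbol_P_nonzero: "symbol P \<noteq> 0"
  using symbol_P_at_0 by auto

lemma tame_Q: "tame Q"
  unfolding tame_def commutator_Q_P using Q_over
  by (auto simp: one_weyl.rep_eq intro!: exI[of _ 1])

lemma tame_imp_nonzero: "tame F \<Longrightarrow> F \<noteq> 0"
  by (auto simp: tame_def)

lemma has_symbol_commutator_P:
  "has_symbol (commutator F P) (ord F + ord P - 1) (wronskian (ord F) (ord P) (symbol F) (symbol P))"
  using ord_P_pos by (intro has_symbol_commutator has_symbol_symbol) simp

lemma ord_commutator_le: "ord (commutator F P) \<le> ord F + ord P - 1"
  using has_symbol_commutator_P[of F] by (simp add: has_symbol_def)

lemma nongeneric_symbol:
  assumes "tame F" "\<not> generic F"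
  obtains \<kappa> where "\<kappa> \<noteq> 0" "symbol F ^ ord P = smult \<kappa> (symbol P ^ ord F)"
proof -
  have "ord (commutator F P) < ord F + ord P - 1"
    using assms(2) ord_commutator_le[of F] by (simp add: generic_def)
  then have "wronskian (ord F) (ord P) (symbol F) (symbol P) = 0"
    using has_symbol_commutator_P[of F] coeff_eq_0 unfolding has_symbol_def by metis
  with tame_imp_nonzero[OF assms(1)] show ?thesis
    by (intro wronskian_0_imp_power_proportional[OF _ _ symbol_P_nonzero that])
       (simp_all add: Rep_weyl_eq_0_iff)
qed

text \<open>The highest exponents of nongeneric operators thus lie on the line through those of
  \<open>P\<close>; this later yields \<open>Hm(Q)\<close> and the divisibility by
  \<open>EssGCD P Q\<close>.\<close>

lemma nongeneric_symbol_degree: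
  assumes "tame F" "\<not> generic F"
  shows "ord P * degree (symbol F) = ord F * degree (symbol P)"
proof -
  obtain \<kappa> where "\<kappa> \<noteq> 0" "symbol F ^ ord P = smult \<kappa> (symbol P ^ ord F)"
    using nongeneric_symbol[OF assms] .
  then have "degree (symbol F ^ ord P) = degree (symbol P ^ ord F)" by simp
  then show ?thesis
    using tame_imp_nonzero[OF assms(1)] symbol_P_nonzero
    by (simp add: degree_power_eq Rep_weyl_eq_0_iff)
qed

text \<open>A nongeneric symbol has a power proportional to one of \<open>symbol P\<close>. For a
  generic one the symbol of the commutator is the Wronskian, so tameness is the hypothesis of the
  root count.\<close>

lemma tame_symbol_at_0:
  assumes "tame F"
  shows "poly (symbol F) 0 \<noteq> 0"
proof (cases "generic F")
  case False
  obtain \<kappa> where \<kappa>: "\<kappa> \<noteq> 0" "symbol F ^ ord P = smult \<kappa> (symbol P ^ ord F)"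
    using nongeneric_symbol[OF assms False] .
  from arg_cong[OF \<kappa>(2), of "\<lambda>h. poly h 0"] \<kappa>(1) symbol_P_at_0
  have "poly (symbol F) 0 ^ ord P \<noteq> 0" by simp
  then show ?thesis using ord_P_pos by (auto simp: power_0_left)
next
  case True
  then have ord: "ord (commutator F P) = ord F + ord P - 1" by (simp only: generic_def)
  with has_symbol_commutator_P[of F]
  have "symbol (commutator F P) = wronskian (ord F) (ord P) (symbol F) (symbol P)"
    unfolding has_symbol_def by simp
  moreover obtain \<kappa> where "\<kappa> \<noteq> 0" and
    "symbol (commutator F P) ^ ord P = smult \<kappa> (symbol P ^ ord (commutator F P))"
    using assms unfolding tame_def by blast
  ultimately have "wronskian (ord F) (ord P) (symbol F) (symbol P) ^ ord P
       = smult \<kappa> (symbol P ^ (ord F + ord P - 1))"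
    by (simp only: ord)
  from wronskian_power_imp_nonzero_at_0[OF this \<open>\<kappa> \<noteq> 0\<close> symbol_P_at_0 symbol_P_degree(2,1)]
  show ?thesis .
qed

text \<open>Otherwise \<open>F\<close> would be a constant and commute with \<open>P\<close>.
  Positivity is needed because \<open>ord F\<close> serves as an exponent.\<close>

lemma nongeneric_ord_pos:
  assumes "tame F" "\<not> generic F"
  shows "ord F > 0"
proof (rule ccontr)
  assume "\<not> ord F > 0"
  then have ord: "ord F = 0" by simp
  then have "degree (symbol F) = 0" using nongeneric_symbol_degree[OF assms] ord_P_pos by simp
  then obtain c where c: "symbol F = [:c:]" by (rule degree_eq_zeroE)
  from ord obtain f where f: "Rep_weyl F = [:f:]" by (rule degree_eq_zeroE)
  have "Rep_weyl F = [:[:c:]:]" using c f by simp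
  with commutator_constant assms(1) show False by (simp add: tame_def)
qed

text \<open>The symbol of the new commutator is \<open>k * symbol F ^ (k - 1)\<close> times the old
  one, and the \<open>ord P\<close>-th powers of both symbols are multiples of powers of
  \<open>symbol P\<close>.\<close>

lemma tame_step:
  fixes m :: nat
  assumes F: "tame F" and ng: "\<not> generic F" and k: "k > 0" and \<epsilon>: "\<epsilon> \<in> K"
  defines "G \<equiv> F ^ k - weyl_scale \<epsilon> (P ^ m)"
  shows "tame G" "ord (commutator G P) = (k - 1) * ord F + ord (commutator F P)"
proof -
  let ?B = "commutator F P"
  obtain j where j: "k = Suc j" using k by (cases k) auto
  have GP: "commutator G P = commutator (F ^ k) P"
    unfolding G_def by (rule commutator_diff_scale_power)
  have FK: "F \<in> weyl_over K" and "?B \<noteq> 0" using F unfolding tame_def by blast+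
  then have nz: "symbol F \<noteq> 0" "symbol ?B \<noteq> 0"
    using tame_imp_nonzero[OF F] unfolding symbol_eq_0_iff by blast+
  have "has_symbol (commutator (F ^ Suc j) P) (j * ord F + ord ?B)
      (of_nat (Suc j) * symbol F ^ j * symbol ?B)"
    by (intro has_symbol_commutator_power has_symbol_symbol)
  moreover have nz': "of_nat (Suc j) * symbol F ^ j * symbol ?B \<noteq> 0"
    using nz unfolding mult_eq_0_iff power_eq_0_iff of_nat_eq_0_iff by simp
  ultimately have *: "ord (commutator G P) = j * ord F + ord ?B"
    "symbol (commutator G P) = of_nat (Suc j) * symbol F ^ j * symbol ?B"
    unfolding GP j by (rule ord_symbol_eqI[THEN conjunct1], rule ord_symbol_eqI[THEN conjunct2])
  then show "ord (commutator G P) = (k - 1) * ord F + ord ?B" by (simp add: j)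
  obtain \<kappa> where \<kappa>: "\<kappa> \<noteq> 0" "symbol F ^ ord P = smult \<kappa> (symbol P ^ ord F)"
    using nongeneric_symbol[OF F ng] .
  obtain \<mu> where \<mu>: "\<mu> \<noteq> 0" "symbol ?B ^ ord P = smult \<mu> (symbol P ^ ord ?B)"
    using F unfolding tame_def by blast
  have "symbol (commutator G P) ^ ord P
      = of_nat (Suc j) ^ ord P * (symbol F ^ ord P) ^ j * symbol ?B ^ ord P"
    unfolding *(2) power_mult_distrib
    by (simp only: power_mult[symmetric] mult.commute[of j "ord P"])
  also have "\<dots> = of_nat (Suc j) ^ ord P * smult \<kappa> (symbol P ^ ord F) ^ j
      * smult \<mu> (symbol P ^ ord ?B)"
    by (simp only: \<kappa>(2) \<mu>(2))
  also have "\<dots> = smult (of_nat (Suc j) ^ ord P * \<kappa> ^ j * \<mu>)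
      ((symbol P ^ ord F) ^ j * symbol P ^ ord ?B)"
    unfolding smult_power of_nat_poly poly_const_pow
    by (simp add: mult_ac del: of_nat_Suc)
  also have "(symbol P ^ ord F) ^ j * symbol P ^ ord ?B = symbol P ^ (j * ord F + ord ?B)"
    by (simp only: power_add power_mult[symmetric] mult.commute[of "ord F" j])
  finally have "symbol (commutator G P) ^ ord P = smult (of_nat (Suc j) ^ ord P * \<kappa> ^ j * \<mu>)
      (symbol P ^ ord (commutator G P))" by (simp only: *(1))
  moreover have "of_nat (Suc j) ^ ord P * \<kappa> ^ j * \<mu> \<noteq> 0"
    using \<kappa>(1) \<mu>(1) by (simp del: of_nat_Suc)
  moreover have "G \<in> weyl_over K"
    unfolding G_def by (intro weyl_over_diff weyl_over_power weyl_over_scale subfield FK P_over \<epsilon>)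
  moreover have "commutator G P \<noteq> 0"
    using nz' unfolding *(2)[symmetric] symbol_eq_0_iff .
  ultimately show "tame G" unfolding tame_def by blast
qed

section \<open>Descent and its termination\<close>

lemma ord_power:
  assumes "F \<noteq> 0"
  shows "ord (F ^ k) = k * ord F"
  using degree_eq_has_symbol[OF has_symbol_power[OF has_symbol_symbol]] assms
  by (simp add: Rep_weyl_eq_0_iff)

lemma weyl_scale_0: "weyl_scale 0 X = 0"
  by transfer simp

text \<open>The case of constant 0 in \<open>tame_step\<close>. The orders of \<open>F\<close> and
  of its commutator grow by the same amount, so the gap to the maximal order stays.\<close>

lemma nongeneric_power:
  assumes F: "tame F" and ng: "\<not> generic F" and k: "k > 0"
  shows "tame (F ^ k)" "\<not> generic (F ^ k)"
proof -
  have eq: "F ^ k = F ^ k - weyl_scale 0 (P ^ 1)" by (simp add: weyl_scale_0)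
  show "tame (F ^ k)"
    by (subst eq) (intro tame_step F ng k subfield_0 subfield)
  have "ord (commutator (F ^ k) P) = (k - 1) * ord F + ord (commutator F P)"
    by (subst eq) (intro tame_step F ng k subfield_0 subfield)
  moreover have "ord (commutator F P) < ord F + ord P - 1"
    using ng ord_commutator_le[of F] by (simp add: generic_def)
  moreover have "ord (F ^ k) = (k - 1) * ord F + ord F"
    using k by (cases k) (simp_all add: ord_power tame_imp_nonzero[OF F] del: power_Suc)
  ultimately show "\<not> generic (F ^ k)" by (simp add: generic_def)
qed

text \<open>For nongeneric tame \<open>F\<close> this is the proportionality constant between the
  powers of the symbols. Evaluating at 0, where \<open>symbol P\<close> is nonzero, shows that it
  lies in \<open>K\<close>.\<close>

definition symbol_ratio :: "weyl \<Rightarrow> complex" where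
  "symbol_ratio F = poly (symbol F) 0 ^ ord P / poly (symbol P) 0 ^ ord F"

definition descend :: "weyl \<Rightarrow> weyl" where
  "descend F = F ^ ord P - weyl_scale (symbol_ratio F) (P ^ ord F)"

lemma symbol_ratio_in_K:
  assumes "tame F"
  shows "symbol_ratio F \<in> K"
proof -
  have "poly (symbol X) 0 \<in> K" if "X \<in> weyl_over K" for X
    using that by (simp add: weyl_over_def[OF subfield] bipoly_over_def poly_0_coeff_0)
  then show ?thesis
    using assms P_over unfolding symbol_ratio_def tame_def
    by (intro subfield_divide subfield_power subfield) blast+
qed

lemma tame_descend:
  assumes "tame F" "\<not> generic F"
  shows "tame (descend F)"
  unfolding descend_def using assms by (intro tame_step symbol_ratio_in_K ord_P_pos)

lemma ord_descend_less:
  assumes F: "tame F" and ng: "\<not> generic F"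
  shows "ord (descend F) < ord P * ord F"
proof -
  obtain \<kappa> where \<kappa>: "\<kappa> \<noteq> 0" "symbol F ^ ord P = smult \<kappa> (symbol P ^ ord F)"
    using nongeneric_symbol[OF F ng] .
  from arg_cong[OF \<kappa>(2), of "\<lambda>h. poly h 0"] symbol_P_at_0
  have ratio: "symbol_ratio F = \<kappa>" by (simp add: symbol_ratio_def)
  have "has_symbol (descend F) (ord P * ord F)
      (symbol F ^ ord P - smult \<kappa> (symbol P ^ ord F))"
    unfolding descend_def ratio
    using has_symbol_power[OF has_symbol_symbol, of P "ord F"]
    by (intro has_symbol_diff has_symbol_scale has_symbol_power[OF has_symbol_symbol])
       (simp add: mult.commute)
  then have "ord (descend F) \<le> ord P * ord F" "coeff (Rep_weyl (descend F)) (ord P * ord F) = 0"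
    using \<kappa>(2) by (simp_all add: has_symbol_def)
  moreover have "symbol (descend F) \<noteq> 0"
    using tame_imp_nonzero[OF tame_descend[OF F ng]] by (simp add: symbol_eq_0_iff del: leading_coeff_0_iff)
  ultimately show ?thesis by (metis le_neq_implies_less)
qed

text \<open>The termination measure; by \<open>ord_commutator_le\<close> its outer subtraction is
  not truncated.\<close>

definition defect :: "weyl \<Rightarrow> nat" where
  "defect F = ord F + ord P - 1 - ord (commutator F P)"

text \<open>The order of the commutator grows by exactly \<open>(ord P - 1) * ord F\<close>, that of
  the operator by less, because its top terms cancel.\<close>

lemma defect_descend_less:
  assumes F: "tame F" and ng: "\<not> generic F"
  shows "defect (descend F) < defect F"
proof -
  have "ord (commutator (descend F) P) = (ord P - 1) * ord F + ord (commutator F P)"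
    unfolding descend_def using F ng by (intro tame_step symbol_ratio_in_K ord_P_pos)
  moreover have "ord P * ord F = (ord P - 1) * ord F + ord F"
    using ord_P_pos by (cases "ord P") auto
  moreover have "ord (commutator F P) < ord F + ord P - 1"
    using ng ord_commutator_le[of F] by (simp add: generic_def)
  moreover note ord_descend_less[OF F ng] ord_commutator_le[of "descend F"]
  ultimately show ?thesis unfolding defect_def by linarith
qed

lemma descend_terminates:
  obtains k where "generic ((descend ^^ k) Q)"
    "\<And>j. j \<le> k \<Longrightarrow> tame ((descend ^^ j) Q)" "\<And>j. j < k \<Longrightarrow> \<not> generic ((descend ^^ j) Q)"
proof -
  let ?H = "\<lambda>k. (descend ^^ k) Q"
  have tame: "tame (?H k)" if "\<And>j. j < k \<Longrightarrow> \<not> generic (?H j)" for k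
    using that by (induction k) (auto intro: tame_Q tame_descend)
  have "\<exists>k. generic (?H k)"
  proof (rule ccontr)
    assume "\<nexists>k. generic (?H k)"
    then have less: "defect (?H (Suc k)) < defect (?H k)" for k
      using tame[of k] by (simp add: defect_descend_less)
    have "defect (?H k) + k \<le> defect Q" for k
    proof (induction k)
      case (Suc k)
      with less[of k] show ?case by linarith
    qed simp
    from this[of "Suc (defect Q)"] show False by simp
  qed
  \<comment> \<open>The least such index is taken, since tameness is propagated only through
    nongeneric operators.\<close>
  then have gen: "generic (?H (LEAST k. generic (?H k)))" by (rule LeastI_ex)
  show ?thesis
  proof (rule that[OF gen])
    show nongen: "\<not> generic (?H j)" if "j < (LEAST k. generic (?H k))" for j
      using that by (rule not_less_Least)
    show "tame (?H j)" if "j \<le> (LEAST k. generic (?H k))" for j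
      using that by (intro tame nongen) simp
  qed
qed

text \<open>
  A single step of the recursion with exponents \<open>ord P\<close> and \<open>ord F\<close> would need an \<open>ord P\<close>-th root of
  \<open>symbol_ratio F\<close>, which need not lie in \<open>K\<close>. So \<open>descend\<close> is spread over two steps: first the plain
  power \<open>F ^ ord P\<close> (with \<open>\<epsilon> = 0\<close>), then the subtraction with exponent \<open>1\<close> on the left.
\<close>

lemma tame_F_op_sequence:
  obtains I ns ms \<epsilon> where
    "\<And>i. i \<le> I \<Longrightarrow> ns i \<ge> 1 \<and> ms i \<ge> 1 \<and> \<epsilon> i \<in> K \<and> tame (F_op ns ms \<epsilon> P Q i)"
    "\<And>i. i < I \<Longrightarrow> \<not> generic (F_op ns ms \<epsilon> P Q i)"
    "generic (F_op ns ms \<epsilon> P Q I)"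
proof -
  obtain k where gen: "generic ((descend ^^ k) Q)"
    and tame: "\<And>j. j \<le> k \<Longrightarrow> tame ((descend ^^ j) Q)"
    and nongen: "\<And>j. j < k \<Longrightarrow> \<not> generic ((descend ^^ j) Q)"
    using descend_terminates by blast
  \<comment> \<open>Each iterate of \<open>descend\<close> occupies an even index and the following
    odd one, where its power stands.\<close>
  define H where "H i = (descend ^^ (i div 2)) Q" for i
  define ns ms :: "nat \<Rightarrow> nat" where
    "ns i = (if even i then ord P else 1)" and "ms i = (if even i then 1 else ord (H i))" for i
  define \<epsilon> where "\<epsilon> i = (if even i then 0 else symbol_ratio (H i))" for i
  have F: "F_op ns ms \<epsilon> P Q i = (if even i then H i else H i ^ ord P)" for i
  proof (induction i)
    case (Suc i)
    show ?case
    proof (cases "even i")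
      case True
      with Suc ord_P_pos show ?thesis
        by (simp add: ns_def ms_def \<epsilon>_def weyl_scale_0 H_def power_0_left)
    next
      case False
      with Suc show ?thesis
        by (simp add: ns_def ms_def \<epsilon>_def H_def descend_def odd_Suc_div_two)
    qed
  qed (simp add: H_def)
  have H: "tame (H i)" "\<not> generic (H i)" if "i < 2 * k" for i
    using that tame[of "i div 2"] nongen[of "i div 2"] by (auto simp: H_def)
  show ?thesis
  proof (rule that[of "2 * k" ns ms \<epsilon>])
    show "generic (F_op ns ms \<epsilon> P Q (2 * k))" using gen by (simp add: F H_def)
    show "\<not> generic (F_op ns ms \<epsilon> P Q i)" if "i < 2 * k" for i
      using H[OF that] nongeneric_power ord_P_pos by (simp add: F)
    fix i assume "i \<le> 2 * k"
    then consider "i < 2 * k" | "i = 2 * k" by linarith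
    then show "ns i \<ge> 1 \<and> ms i \<ge> 1 \<and> \<epsilon> i \<in> K \<and> tame (F_op ns ms \<epsilon> P Q i)"
    proof cases
      case 1
      from H[OF 1] nongeneric_ord_pos[OF H[OF 1]] ord_P_pos show ?thesis
        by (auto simp: ns_def ms_def \<epsilon>_def F Suc_le_eq subfield_0[OF subfield]
            intro: symbol_ratio_in_K nongeneric_power)
    next
      case 2
      with tame[of k] ord_P_pos show ?thesis
        by (auto simp: ns_def ms_def \<epsilon>_def F H_def Suc_le_eq subfield_0[OF subfield])
    qed
  qed
qed

end

section \<open>Divisibility and the conclusion\<close>

lemma div_gcd_dvd_of_dvd_mult:
  fixes d l s :: nat
  assumes "d > 0" "d dvd s * l"
  shows "d div gcd l d dvd s"
proof -
  define g where "g = gcd l d"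
  have g: "g > 0" "d = g * (d div g)" "l = g * (l div g)" using assms(1) by (simp_all add: g_def)
  have "g * (d div g) dvd g * (s * (l div g))"
    using assms(2) g(2,3) by (metis mult.left_commute)
  then have "d div g dvd s * (l div g)" using g(1) by simp
  moreover have "coprime (d div g) (l div g)"
    using assms(1) div_gcd_coprime[of d l] by (simp add: g_def gcd.commute)
  ultimately show ?thesis by (simp add: coprime_dvd_mult_left_iff g_def)
qed

theorem theorem4p1:
  fixes \<phi> :: "weyl \<Rightarrow> weyl" and P Q :: weyl
    and p q d n m l :: nat and K :: "complex set"
  assumes "subrectangular_endo \<phi>" and "\<not> weyl_auto \<phi>"
    and "P = \<phi> weyl_x" and "Q = \<phi> weyl_d"
    and "weyl_ord P = p" and "p = d * n"
    and "weyl_ord Q = q" and "q = d * m"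
    and "d > 1" and "coprime n m" and "n > 1" and "m > 1"
    and "has_Hm P (l * n) (d * n)" and "l < d"
    and "int (weyl_ord P) = weyl_bold_ord P"
    and "int (weyl_ord Q) = weyl_bold_ord Q"
    and "K = coeff_field P Q"
  shows "\<exists>(I :: nat) (ns :: nat \<Rightarrow> nat) (ms :: nat \<Rightarrow> nat) (\<epsilon> :: nat \<Rightarrow> complex).
      (\<forall>i\<le>I. ns i \<ge> 1 \<and> ms i \<ge> 1 \<and> \<epsilon> i \<in> K \<and> F_poly ns ms \<epsilon> i \<in> bipoly_over K) \<and>
      (\<forall>i\<le>I. F_op ns ms \<epsilon> P Q i \<noteq> 0) \<and>
      (\<forall>i<I.
         EssGCD P Q dvd
           Gcd (insert (weyl_ord P) ((\<lambda>k. weyl_ord (F_op ns ms \<epsilon> P Q k)) ` {..i})) \<and>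
         Gcd (insert (weyl_ord P) ((\<lambda>k. weyl_ord (F_op ns ms \<epsilon> P Q k)) ` {..i})) dvd d) \<and>
      [weyl_ord (F_op ns ms \<epsilon> P Q I) = 1]
        (mod Gcd (insert (weyl_ord P) ((\<lambda>k. weyl_ord (F_op ns ms \<epsilon> P Q k)) ` {..<I}))) \<and>
      (\<Sum>i<I. int (ns i) * int (weyl_ord (F_op ns ms \<epsilon> P Q i))
                - int (weyl_ord (F_op ns ms \<epsilon> P Q (Suc i)))) = int p + int q - 1 \<and>
      (\<forall>i\<le>I. int (weyl_ord (F_op ns ms \<epsilon> P Q i)) = weyl_bold_ord (F_op ns ms \<epsilon> P Q i))"
proof -
  have endo: "weyl_endo \<phi>" and "subrectangular Q"
    using assms(1,4) by (auto simp: subrectangular_endo_def)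
  from this(2) obtain lQ kQ where HmQ: "has_Hm Q lQ kQ" by (auto simp: subrectangular_def)
  note HmP = assms(13)
  have P0: "P \<noteq> 0" and "l * n \<ge> 1" using HmP by (auto simp: has_Hm_def)
  have Q0: "Q \<noteq> 0" using HmQ by (simp add: has_Hm_def)
  have ordP: "ord P = d * n" and ordQ: "ord Q = d * m"
    using assms(5-8) P0 Q0 by (simp_all add: weyl_ord_eq_degree)
  have minus: "\<phi> (A - B) = \<phi> A - \<phi> B" for A B
  proof -
    have "\<phi> (A - B) + \<phi> B = \<phi> (A - B + B)" using endo unfolding weyl_endo_def by metis
    then show ?thesis by (simp add: algebra_simps)
  qed
  have "commutator Q P = \<phi> (weyl_d * weyl_x - weyl_x * weyl_d)"
    using endo unfolding commutator_def assms(3,4) minus weyl_endo_def by simp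
  also have "\<dots> = 1" using endo by (simp add: weyl_commutator weyl_endo_def)
  finally have comm: "commutator Q P = 1" .
  interpret dixmier_pair P Q K
  proof
    show "commutator Q P = 1" by (rule comm)
    show "is_subfield K" "P \<in> weyl_over K" "Q \<in> weyl_over K"
      unfolding assms(17) by (rule is_subfield_coeff_field weyl_over_coeff_field)+
    show "poly (symbol P) 0 \<noteq> 0" using P0 assms(15) by (rule weyl_ord_eq_bold_ord_imp)
    show "degree (symbol P) > 0" "degree (symbol P) < ord P"
      using has_Hm_imp(3)[OF HmP] \<open>l * n \<ge> 1\<close> assms(11,14) by (simp_all add: ordP)
  qed
  have degP: "degree (symbol P) = l * n" by (rule has_Hm_imp(3)[OF HmP])
  \<comment> \<open>The degree relation for nongeneric operators with the common factor
    \<open>n\<close> cancelled.\<close>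
  have d_dvd: "d * degree (symbol F) = ord F * l" if "tame F" "\<not> generic F" for F
  proof -
    have "n * (d * degree (symbol F)) = n * (ord F * l)"
      using nongeneric_symbol_degree[OF that, unfolded degP] unfolding ordP by (simp add: mult_ac)
    then show ?thesis using assms(11) by simp
  qed
  have "d * n > 1" using assms(9,11) by (rule less_1_mult)
  moreover have "d * m > 1" using assms(9,12) by (rule less_1_mult)
  \<comment> \<open>The commutator 1 has order 0, while the maximal order
    \<open>ord Q + ord P - 1\<close> is positive.\<close>
  ultimately have "\<not> generic Q"
    by (simp add: generic_def comm one_weyl.rep_eq ordP ordQ)
  from d_dvd[OF tame_Q this] have "d * lQ = d * (l * m)"
    unfolding has_Hm_imp(3)[OF HmQ] unfolding ordQ by (simp add: mult_ac)
  then have lQ: "lQ = l * m" using assms(9) by simp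
  have gcd_d: "gcd (d * n) (d * m) = d" and gcd_l: "gcd (l * n) (l * m) = l"
    using assms(10) by (simp_all add: gcd_mult_left coprime_iff_gcd_eq_1)
  have ess: "EssGCD P Q = d div gcd l d"
    unfolding EssGCD_def Let_def has_Hm_imp(2)[OF HmP] has_Hm_imp(2)[OF HmQ] lQ
    by (simp add: weyl_ord_eq_degree P0 Q0 ordP ordQ gcd_d gcd_l)
  obtain I ns ms \<epsilon> where
    seq: "\<And>i. i \<le> I \<Longrightarrow> ns i \<ge> 1 \<and> ms i \<ge> 1 \<and> \<epsilon> i \<in> K \<and> tame (F_op ns ms \<epsilon> P Q i)"
    and nongen: "\<And>i. i < I \<Longrightarrow> \<not> generic (F_op ns ms \<epsilon> P Q i)"
    and gen: "generic (F_op ns ms \<epsilon> P Q I)"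
    using tame_F_op_sequence by blast
  define F where "F = F_op ns ms \<epsilon> P Q"
  have F0: "F 0 = Q" by (simp add: F_def)
  have tame: "tame (F i)" if "i \<le> I" for i using seq[OF that] by (simp add: F_def)
  have wo: "weyl_ord (F i) = ord (F i)" if "i \<le> I" for i
    using tame_imp_nonzero[OF tame[OF that]] by (rule weyl_ord_eq_degree)
  have step: "int (ord (commutator (F (Suc i)) P))
      = (int (ns i) - 1) * int (ord (F i)) + int (ord (commutator (F i) P))" if "i < I" for i
  proof -
    have "ord (commutator (F (Suc i)) P) = (ns i - 1) * ord (F i) + ord (commutator (F i) P)"
      unfolding F_def F_op.simps
      using seq[of i] that nongen[OF that]
      \<comment> \<open>The constant passed to \<open>tame_step\<close> is
        \<open>\<epsilon> i ^ ns i\<close>.\<close>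
      by (intro tame_step subfield_power subfield) auto
    then show ?thesis using seq[of i] that by (simp add: of_nat_diff)
  qed
  \<comment> \<open>The sum starts from 0, the order of \<open>commutator Q P = 1\<close>.\<close>
  have telescope: "int (ord (commutator (F i) P)) = (\<Sum>k<i. (int (ns k) - 1) * int (ord (F k)))"
    if "i \<le> I" for i
    using that by (induction i) (simp_all add: step F0 comm one_weyl.rep_eq)
  have ordI: "int (ord (F I)) + int p - 1 = (\<Sum>k<I. (int (ns k) - 1) * int (ord (F k)))"
  proof -
    have "ord (commutator (F I) P) = ord (F I) + p - 1" "p > 0"
      using gen ord_P_pos assms(6) by (simp_all only: generic_def F_def ordP)
    then have "int (ord (F I)) + int p - 1 = int (ord (commutator (F I) P))" by linarith
    then show ?thesis using telescope[of I] by simp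
  qed
  \<comment> \<open>Each summand splits into the one of \<open>ordI\<close> and a difference of
    consecutive orders, which telescopes.\<close>
  have "(\<Sum>i<I. int (ns i) * int (weyl_ord (F i)) - int (weyl_ord (F (Suc i))))
      = (\<Sum>i<I. (int (ns i) - 1) * int (ord (F i)) + (int (ord (F i)) - int (ord (F (Suc i)))))"
    by (intro sum.cong) (simp_all add: wo algebra_simps)
  also have "\<dots> = int (ord (F I)) + int p - 1 + (int (ord (F 0)) - int (ord (F I)))"
    unfolding sum.distrib ordI[symmetric] by (subst sum_lessThan_telescope') simp
  finally have sum: "(\<Sum>i<I. int (ns i) * int (weyl_ord (F i)) - int (weyl_ord (F (Suc i))))
      = int p + int q - 1"
    using assms(8) by (simp add: F0 ordQ)
  let ?g = "\<lambda>A. Gcd (insert (weyl_ord P) ((\<lambda>k. weyl_ord (F k)) ` A))"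
  have ess_dvd: "EssGCD P Q dvd ?g {..i}" if "i < I" for i
  proof -
    have "EssGCD P Q dvd weyl_ord (F k)" if "k \<le> i" for k
    proof -
      have k: "k < I" using that \<open>i < I\<close> by simp
      then have "d dvd ord (F k) * l"
        using d_dvd[of "F k"] tame[of k] nongen[of k] by (metis F_def dvd_triv_left less_imp_le)
      then show ?thesis
        using k assms(9) by (simp add: ess wo div_gcd_dvd_of_dvd_mult)
    qed
    moreover have "EssGCD P Q dvd weyl_ord P"
      unfolding ess assms(5,6) by (intro div_gcd_dvd_of_dvd_mult) (use assms(9) in auto)
    ultimately show ?thesis by (intro Gcd_greatest) auto
  qed
  have g_dvd: "?g {..i} dvd d" for i
  proof -
    have "?g {..i} dvd weyl_ord P" by (rule Gcd_dvd) simp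
    moreover have "?g {..i} dvd weyl_ord (F 0)" by (rule Gcd_dvd) auto
    ultimately show ?thesis
      using gcd_greatest[of "?g {..i}" "d * n" "d * m"] by (simp add: gcd_d assms(5-8) F0)
  qed
  \<comment> \<open>\<open>ordI\<close> is read modulo the gcd, which divides \<open>p\<close> and
    every order on the right-hand side.\<close>
  have cong: "[weyl_ord (F I) = 1] (mod ?g {..<I})"
  proof -
    let ?G = "int (?g {..<I})"
    have "?G dvd int (ord (F k))" if "k < I" for k
    proof -
      have "?g {..<I} dvd weyl_ord (F k)" by (rule Gcd_dvd) (use that in auto)
      then show ?thesis using that by (simp only: wo less_imp_le int_dvd_int_iff)
    qed
    then have "?G dvd (\<Sum>k<I. (int (ns k) - 1) * int (ord (F k)))"
      by (intro dvd_sum dvd_mult) auto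
    moreover have "?g {..<I} dvd p" using assms(5) by (intro Gcd_dvd) simp
    then have "?G dvd int p" by (simp only: int_dvd_int_iff)
    ultimately have "?G dvd (int (ord (F I)) + int p - 1) - int p"
      unfolding ordI[symmetric] by (rule dvd_diff)
    then have "[int (weyl_ord (F I)) = int 1] (mod ?G)"
      by (simp add: cong_iff_dvd_diff wo)
    then show ?thesis by (simp only: cong_int_iff)
  qed
  have bold: "int (weyl_ord (F i)) = weyl_bold_ord (F i)" if "i \<le> I" for i
    using weyl_bold_ord_eq_degree[OF tame_symbol_at_0[OF tame[OF that]]] by (simp add: wo that)
  have poly: "F_poly ns ms \<epsilon> i \<in> bipoly_over K" if "i \<le> I" for i
    using seq that by (intro F_poly_in_bipoly_over subfield) simp
  show ?thesis
    using seq tame tame_imp_nonzero ess_dvd g_dvd cong sum bold poly unfolding F_def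
    by (intro exI[of _ I] exI[of _ ns] exI[of _ ms] exI[of _ \<epsilon>] conjI allI impI) auto
qed

end
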